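(* Let $(\mathcal U_n)_{n\ge1}$ be a sequence of taut tree-chains in $\mathbb R^2$ such that (1) for each positive integer $n$, $\mathcal U_{n+1}$ strongly refines $\mathcal U_n$; (2) $\lim_{n\to\infty}\operatorname{mesh}(\mathcal U_n)=0$; (3) $(\mathcal U_n)$ follows a type-(D2') fixed-point-free pattern. Then $X=\bigcap_{n=1}^\infty\left(\bigcup\mathcal U_n\right)$ is a tree-like continuum in $\mathbb R^2$ that does not have the fixed-point property. If there is no such sequence (of taut tree-chains in $\mathbb R^2$ satisfying (1), (2) and (3)), then every planar tree-like continuum has the fixed-point property.
   Context: A continuum is a nonempty compact connected metric space. A graph is a continuum that is a union of finitely many arcs, any two of which are either disjoint or intersect in one or both of their end points; a tree is a graph containing no simple closed curve. A space $X$ has the fixed-point property if every continuous $f:X\to X$ has a point $p$ with $f(p)=p$. A tree-chain in a metric space is a (finite) family of open subsets such that the geometric realization of its nerve is a tree. A continuum $X$ is tree-like if each open cover of $X$ can be refined by a finite open cover of $X$ the geometric realization of whose nerve is a tree. A planar continuum is one embedded in $\mathbb R^2$. A family $\mathcal U$ of subsets is taut if for all $U,V\in\mathcal U$ with $U\cap V=\emptyset$ one has $\operatorname{cl}(U)\cap\operatorname{cl}(V)=\emptyset$. The mesh of a family is the supremum of the diameters of its members. $\mathcal V$ strongly refines $\mathcal U$ if for each $V\in\mathcal V$ there is $U\in\mathcal U$ with $\operatorname{cl}(V)\subseteq U$. A sequence $(\mathcal U_n)_{n\ge1}$ of finite families of subsets of a metric space follows a type-(D2') fixed-point-free pattern if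 there are functions $\varphi_n:\mathcal U_{n+1}\to\mathcal U_n$ ($n\ge1$) such that: (D1) for all $U\in\mathcal U_1$, $V\in\mathcal U_2$: $U\cap V\ne\emptyset\Rightarrow\varphi_1(V)\cap U=\emptyset$; (D2') for each positive integer $n$ and all $U\in\mathcal U_{n+2}$, $V\in\mathcal U_{n+1}$: $\operatorname{cl}(U)\subseteq V\Rightarrow\varphi_{n+1}(U)\subseteq\varphi_n(V)$; (D3) for each positive integer $n$ and all $U,V\in\mathcal U_{n+1}$: $U\cap V\ne\emptyset\Rightarrow\varphi_n(U)\cap\varphi_n(V)\neq\emptyset$. *)

theory Defs
  imports "HOL-Analysis.Analysis"
begin

section \<open>Continua, graphs and trees\<close>

text \<open>
  Spaces are subsets of a topological type with the subspace topology. The metrizability conjunct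
  holds automatically for subsets of a metric type; it is stated because geometric realizations
  below live in a function type with the product topology.
\<close>

definition continuum :: "'a::topological_space set \<Rightarrow> bool" where
  "continuum S \<longleftrightarrow> S \<noteq> {} \<and> compact S \<and> connected S \<and> metrizable_space (top_of_set S)"

text \<open>
  Arcs are given by injective parametrizations on \<open>[0, 1]\<close>, so they are nondegenerate and a
  single point is not a graph. The condition on pairs covers the disjoint case.
\<close>

definition is_graph :: "'a::topological_space set \<Rightarrow> bool" where
  "is_graph S \<longleftrightarrow> continuum S \<and>
     (\<exists>G. finite G \<and> (\<forall>g\<in>G. arc g) \<and> S = (\<Union>g\<in>G. path_image g) \<and>
        pairwise (\<lambda>g h. path_image g \<inter> path_image h \<subseteq>
          {pathstart g, pathfinish g} \<inter> {pathstart h, pathfinish h}) G)"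

definition is_tree :: "'a::topological_space set \<Rightarrow> bool" where
  "is_tree S \<longleftrightarrow> is_graph S \<and>
     \<not> (\<exists>g. simple_path g \<and> pathfinish g = pathstart g \<and> path_image g \<subseteq> S)"

definition fixed_point_property :: "'a::topological_space set \<Rightarrow> bool" where
  "fixed_point_property S \<longleftrightarrow>
     (\<forall>f. continuous_on S f \<and> f \<in> S \<rightarrow> S \<longrightarrow> (\<exists>p\<in>S. f p = p))"


section \<open>Nerves, tree-chains and tree-like continua\<close>

text \<open>The empty set, should it belong to the family, is not a vertex of the nerve.\<close>

definition nerve :: "'a set set \<Rightarrow> 'a set set set" where
  "nerve \<U> = {\<sigma>. \<sigma> \<subseteq> \<U> \<and> finite \<sigma> \<and> \<sigma> \<noteq> {} \<and> \<Inter>\<sigma> \<noteq> {}}"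

text \<open>
  Points are given by barycentric coordinates. The topology is inherited from the product topology
  on \<open>'v \<Rightarrow> real\<close>, which is the usual one for finite complexes.
\<close>

definition geometric_realization :: "'v set set \<Rightarrow> ('v \<Rightarrow> real) set" where
  "geometric_realization K =
     {t. (\<forall>v. 0 \<le> t v) \<and> {v. t v \<noteq> 0} \<in> K \<and> (\<Sum>v | t v \<noteq> 0. t v) = 1}"

definition tree_chain :: "'a::metric_space set set \<Rightarrow> bool" where
  "tree_chain \<U> \<longleftrightarrow>
     finite \<U> \<and> (\<forall>U\<in>\<U>. open U) \<and> is_tree (geometric_realization (nerve \<U>))"

definition tree_like :: "'a::metric_space set \<Rightarrow> bool" where
  "tree_like X \<longleftrightarrow>
     (\<forall>\<U>. (\<forall>U\<in>\<U>. openin (top_of_set X) U) \<and> \<Union>\<U> = X \<longrightarrow>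
        (\<exists>\<V>. finite \<V> \<and> (\<forall>V\<in>\<V>. openin (top_of_set X) V) \<and> \<Union>\<V> = X \<and>
           (\<forall>V\<in>\<V>. \<exists>U\<in>\<U>. V \<subseteq> U) \<and>
           is_tree (geometric_realization (nerve \<V>))))"


section \<open>Families of sets\<close>

definition taut :: "'a::topological_space set set \<Rightarrow> bool" where
  "taut \<U> \<longleftrightarrow> (\<forall>U\<in>\<U>. \<forall>V\<in>\<U>. U \<inter> V = {} \<longrightarrow> closure U \<inter> closure V = {})"

text \<open>
  Diameters take values in \<^typ>\<open>ennreal\<close>, since the members of a tree-chain may be unbounded and
  the real-valued \<^const>\<open>diameter\<close> is meaningless for unbounded sets.
\<close>

definition mesh :: "'a::metric_space set set \<Rightarrow> ennreal" where
  "mesh \<U> = (SUP U\<in>\<U>. SUP (x, y)\<in>U \<times> U. ennreal (dist x y))"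

definition strongly_refines :: "'a::topological_space set set \<Rightarrow> 'a set set \<Rightarrow> bool" where
  "strongly_refines \<V> \<U> \<longleftrightarrow> (\<forall>V\<in>\<V>. \<exists>U\<in>\<U>. closure V \<subseteq> U)"

text \<open>Sequences are indexed by the positive integers; the value at \<open>0\<close> is irrelevant.\<close>

definition follows_D2'_pattern :: "(nat \<Rightarrow> 'a::topological_space set set) \<Rightarrow> bool" where
  "follows_D2'_pattern \<U> \<longleftrightarrow>
     (\<exists>\<phi> :: nat \<Rightarrow> 'a set \<Rightarrow> 'a set.
        (\<forall>n\<ge>1. \<phi> n \<in> \<U> (n + 1) \<rightarrow> \<U> n) \<and>
        (\<forall>U\<in>\<U> 1. \<forall>V\<in>\<U> 2. U \<inter> V \<noteq> {} \<longrightarrow> \<phi> 1 V \<inter> U = {}) \<and>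
        (\<forall>n\<ge>1. \<forall>U\<in>\<U> (n + 2). \<forall>V\<in>\<U> (n + 1).
           closure U \<subseteq> V \<longrightarrow> \<phi> (n + 1) U \<subseteq> \<phi> n V) \<and>
        (\<forall>n\<ge>1. \<forall>U\<in>\<U> (n + 1). \<forall>V\<in>\<U> (n + 1).
           U \<inter> V \<noteq> {} \<longrightarrow> \<phi> n U \<inter> \<phi> n V \<noteq> {}))"

definition fpf_tree_chain_sequence :: "(nat \<Rightarrow> 'a::metric_space set set) \<Rightarrow> bool" where
  "fpf_tree_chain_sequence \<U> \<longleftrightarrow>
     (\<forall>n\<ge>1. tree_chain (\<U> n) \<and> taut (\<U> n)) \<and>
     (\<forall>n\<ge>1. strongly_refines (\<U> (n + 1)) (\<U> n)) \<and>
     (\<lambda>n. mesh (\<U> n)) \<longlonglongrightarrow> 0 \<and>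
     follows_D2'_pattern \<U>"

end

theory Submission
  imports Defs
begin

text \<open>
  A fixed-point-free pattern is a combinatorial blueprint of a map without fixed points on the
  intersection of the tree-chains, and conversely such a map leaves its trace as a pattern on
  tree-chains chosen fine enough.

  Suppose that a sequence of tree-chains with a pattern \<open>\<phi>\<close> is given, and let \<open>X\<close> be the intersection of
  the unions. It is compact as a nested intersection of compact sets, and connected because a
  separation of \<open>X\<close> would separate the nerve of a late stage. A point \<open>x\<close> is sent into the closure of each of
  the sets \<open>\<phi> n V\<close> with \<open>x \<in> V\<close>, up to an error controlled by the mesh: the pattern says that these
  approximations are coherent in \<open>n\<close>, agree with each other at every stage, and at the first stage
  avoid \<open>x\<close> (\<open>fixed_point_free_map\<close>). In particular \<open>X\<close> has two points, and then the traces on \<open>X\<close> of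
  a late stage are a fine cover whose nerve is a tree (\<open>tree_like_X\<close>).

  Conversely, let \<open>f\<close> be a map without fixed points on a tree-like continuum \<open>X\<close>. A fine cover of \<open>X\<close> with
  a tree as nerve is shrunk slightly and then enlarged even less to open sets of the ambient space;
  this makes it taut and keeps the nerve (\<open>taut_tree_cover_exists\<close>). Choosing each stage fine in terms
  of the Lebesgue number of the previous one and of the modulus of continuity of \<open>f\<close>, members that
  generously contain the images \<open>f (X \<inter> V)\<close> form a pattern (\<open>fpf_tree_chain_sequence_exists\<close>).

  Both directions need that a given family has a tree as nerve. This is always
  deduced from another family known to have one, by \<open>is_tree_nerve_of_connected_cover\<close>: a cover
  of a connected set whose intersection pattern embeds into that of a family with a tree as nerve has
  a tree as nerve itself, if it has at least two members.
\<close>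

section \<open>Geometric realizations of nerves\<close>

text \<open>
  The segment from \<open>A\<close> to \<open>B\<close> in barycentric coordinates. The ambient function type is not a
  vector space, so it is not an instance of \<^const>\<open>linepath\<close>.
\<close>

definition edge_path :: "'v \<Rightarrow> 'v \<Rightarrow> real \<Rightarrow> 'v \<Rightarrow> real" where
  "edge_path A B s = (\<lambda>v. if v = A then 1 - s else if v = B then s else 0)"

definition vertex :: "'v \<Rightarrow> 'v \<Rightarrow> real" where
  "vertex A = (\<lambda>v. if v = A then 1 else 0)"

lemma edge_path_ends [simp]:
  "edge_path A B 0 = vertex A" "A \<noteq> B \<Longrightarrow> edge_path A B 1 = vertex B"
  by (auto simp: edge_path_def vertex_def)

text \<open>
  The support of \<open>t\<close> may be a proper face of \<open>\<sigma>\<close>; in this form the rule covers the end points of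
  edges along with their interiors.
\<close>

lemma geometric_realizationI:
  assumes "finite \<sigma>" "\<sigma> \<subseteq> \<U>" "\<Inter>\<sigma> \<noteq> {}" "\<And>v. 0 \<le> t v" "\<And>v. v \<notin> \<sigma> \<Longrightarrow> t v = 0" "sum t \<sigma> = 1"
  shows "t \<in> geometric_realization (nerve \<U>)"
proof -
  let ?S = "{v. t v \<noteq> 0}"
  have sub: "?S \<subseteq> \<sigma>" using assms(5) by auto
  have sum: "sum t ?S = 1"
    using assms(1,6) sub by (metis (mono_tags, lifting) DiffE mem_Collect_eq sum.mono_neutral_left)
  then have ne: "?S \<noteq> {}" by (metis sum.empty zero_neq_one)
  have "?S \<in> nerve \<U>"
    using sub assms(1,2,3) ne finite_subset[OF sub assms(1)] unfolding nerve_def by blast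
  then show ?thesis using assms(4) sum by (simp add: geometric_realization_def)
qed

lemma geometric_realizationD:
  assumes "t \<in> geometric_realization (nerve \<U>)"
  shows "\<And>v. 0 \<le> t v" "\<And>v. v \<notin> \<U> \<Longrightarrow> t v = 0"
    "finite {v. t v \<noteq> 0}" "\<Inter>{v. t v \<noteq> 0} \<noteq> {}" "(\<Sum>v | t v \<noteq> 0. t v) = 1"
  using assms unfolding geometric_realization_def nerve_def by auto

lemma vertex_in_realization:
  assumes "A \<in> \<U>" "A \<noteq> {}"
  shows "vertex A \<in> geometric_realization (nerve \<U>)"
  by (rule geometric_realizationI[of "{A}"]) (use assms in \<open>auto simp: vertex_def\<close>)

lemma edge_in_realization:
  assumes "A \<in> \<U>" "B \<in> \<U>" "A \<noteq> B" "A \<inter> B \<noteq> {}"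
  shows "path_image (edge_path A B) \<subseteq> geometric_realization (nerve \<U>)"
proof
  fix t assume "t \<in> path_image (edge_path A B)"
  then obtain s where s: "0 \<le> s" "s \<le> 1" "t = edge_path A B s"
    by (auto simp: path_image_def)
  show "t \<in> geometric_realization (nerve \<U>)"
    by (rule geometric_realizationI[of "{A, B}"]) (use assms s in \<open>auto simp: edge_path_def\<close>)
qed

lemma continuous_on_coordinate: "continuous_on S (\<lambda>t :: 'v \<Rightarrow> real. t v)"
  by (rule continuous_on_subset[OF continuous_on_product_coordinates subset_UNIV])

lemma continuous_on_if_const:
  assumes "continuous_on S f" "continuous_on S g"
  shows "continuous_on S (\<lambda>x. if b then f x else g x)"
  using assms by (cases b) simp_all

lemma arc_edge_path:
  assumes "A \<noteq> B"
  shows "arc (edge_path A B)"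
  unfolding arc_def path_def
proof
  show "continuous_on {0..1} (edge_path A B)"
    unfolding edge_path_def
    by (intro continuous_on_coordinatewise_then_product continuous_on_if_const continuous_intros)
  show "inj_on (edge_path A B) {0..1}"
    by (rule inj_onI) (use assms in \<open>auto simp: edge_path_def fun_eq_iff split: if_splits\<close>)
qed

text \<open>
  Three pairwise intersecting members span the boundary of a triangle, which is a simple closed curve
  whether or not the triangle itself is filled. Hence a nerve whose realization is a tree is a
  one-dimensional complex, determined by its pairwise intersections.
\<close>

lemma tree_realization_no_triangle:
  assumes tree: "is_tree (geometric_realization (nerve \<U>))"
    and mem: "A \<in> \<U>" "B \<in> \<U>" "C \<in> \<U>" and ne: "A \<noteq> B" "B \<noteq> C" "A \<noteq> C"
    and int: "A \<inter> B \<noteq> {}" "B \<inter> C \<noteq> {}" "A \<inter> C \<noteq> {}"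
  shows False
proof -
  \<comment> \<open>Barycentric coordinates of the loop \<open>A \<rightarrow> B \<rightarrow> C \<rightarrow> A\<close>: tents with peaks at 0 and 1, at 1/3, at 2/3.\<close>
  define a b c :: "real \<Rightarrow> real" where
    "a = (\<lambda>s. max 0 (1 - 3 * s) + max 0 (3 * s - 2))" and
    "b = (\<lambda>s. max 0 (1 - \<bar>3 * s - 1\<bar>))" and
    "c = (\<lambda>s. max 0 (1 - \<bar>3 * s - 2\<bar>))"
  define g where
    "g = (\<lambda>s v. if v = A then a s else if v = B then b s else if v = C then c s else 0)"
  have "continuous_on {0..1} g"
    unfolding g_def a_def b_def c_def
    by (intro continuous_on_coordinatewise_then_product continuous_on_if_const continuous_intros)
  moreover have "loop_free g"
    unfolding loop_free_def
  proof (intro ballI impI)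
    fix x y :: real assume xy: "x \<in> {0..1}" "y \<in> {0..1}" and eq: "g x = g y"
    have "a x = a y" "b x = b y" "c x = c y"
      using fun_cong[OF eq, of A] fun_cong[OF eq, of B] fun_cong[OF eq, of C] ne
      by (auto simp: g_def)
    moreover have "(a s = 1 - 3 * s \<and> b s = 3 * s \<and> c s = 0 \<and> s \<le> 1/3) \<or>
        (a s = 0 \<and> b s = 2 - 3 * s \<and> c s = 3 * s - 1 \<and> 1/3 \<le> s \<and> s \<le> 2/3) \<or>
        (a s = 3 * s - 2 \<and> b s = 0 \<and> c s = 3 - 3 * s \<and> 2/3 \<le> s)"
      if "s \<in> {0..1}" for s
      using that by (auto simp: a_def b_def c_def max_def abs_if)
    from this[OF xy(1)] this[OF xy(2)]
    have "(a x = 1 - 3 * x \<and> b x = 3 * x \<and> c x = 0 \<and> x \<le> 1/3) \<or>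
        (a x = 0 \<and> b x = 2 - 3 * x \<and> c x = 3 * x - 1 \<and> 1/3 \<le> x \<and> x \<le> 2/3) \<or>
        (a x = 3 * x - 2 \<and> b x = 0 \<and> c x = 3 - 3 * x \<and> 2/3 \<le> x)"
      "(a y = 1 - 3 * y \<and> b y = 3 * y \<and> c y = 0 \<and> y \<le> 1/3) \<or>
        (a y = 0 \<and> b y = 2 - 3 * y \<and> c y = 3 * y - 1 \<and> 1/3 \<le> y \<and> y \<le> 2/3) \<or>
        (a y = 3 * y - 2 \<and> b y = 0 \<and> c y = 3 - 3 * y \<and> 2/3 \<le> y)" .
    ultimately show "x = y \<or> x = 0 \<and> y = 1 \<or> x = 1 \<and> y = 0"
      using xy unfolding atLeastAtMost_iff by (elim disjE conjE) linarith+
  qed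
  ultimately have "simple_path g" by (simp add: simple_path_def path_def)
  moreover have "pathfinish g = pathstart g"
    by (auto simp: pathfinish_def pathstart_def g_def a_def b_def c_def)
  moreover have "path_image g \<subseteq> geometric_realization (nerve \<U>)"
  proof
    fix t assume "t \<in> path_image g"
    then obtain s where s: "0 \<le> s" "s \<le> 1" "t = g s" by (auto simp: path_image_def)
    have nonneg: "\<And>v. 0 \<le> t v" by (auto simp: s(3) g_def a_def b_def c_def)
    consider "s \<le> 1/3" | "1/3 \<le> s" "s \<le> 2/3" | "2/3 \<le> s" by linarith
    then show "t \<in> geometric_realization (nerve \<U>)"
    proof cases
      case 1
      show ?thesis
        by (rule geometric_realizationI[of "{A, B}"])
           (use 1 s nonneg mem ne int in \<open>auto simp: g_def a_def b_def c_def\<close>)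
    next
      case 2
      show ?thesis
        by (rule geometric_realizationI[of "{B, C}"])
           (use 2 s nonneg mem ne int in \<open>auto simp: g_def a_def b_def c_def\<close>)
    next
      case 3
      show ?thesis
        by (rule geometric_realizationI[of "{A, C}"])
           (use 3 s nonneg mem ne int in \<open>auto simp: g_def a_def b_def c_def\<close>)
    qed
  qed
  ultimately show False using tree unfolding is_tree_def by blast
qed

text \<open>
  Arcs are nondegenerate, so a tree is not a single point.
\<close>

lemma tree_realization_two_vertices:
  assumes "is_tree (geometric_realization (nerve \<U>))"
  obtains A B where "A \<in> \<U>" "B \<in> \<U>" "A \<noteq> {}" "B \<noteq> {}" "A \<noteq> B"
proof (rule ccontr)
  assume "\<not> thesis"
  with that have single: "A = B" if "A \<in> \<U>" "B \<in> \<U>" "A \<noteq> {}" "B \<noteq> {}" for A B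
    using that by blast
  let ?R = "geometric_realization (nerve \<U>)"
  have eq: "s = t" if s: "s \<in> ?R" and t: "t \<in> ?R" for s t
  proof -
    have supp: "\<exists>A\<in>\<U>. A \<noteq> {} \<and> u = vertex A" if u: "u \<in> ?R" for u
    proof -
      note D = geometric_realizationD[OF u]
      obtain A where A: "u A \<noteq> 0"
        using D(5) by (metis (mono_tags, lifting) mem_Collect_eq sum.neutral zero_neq_one)
      have mem: "v \<in> \<U> \<and> v \<noteq> {}" if "u v \<noteq> 0" for v
        using D(2)[of v] D(4) that by blast
      have S: "{v. u v \<noteq> 0} = {A}" using single A mem by blast
      then have "u A = 1" using D(5) by simp
      then have "u = vertex A" using S by (auto simp: vertex_def fun_eq_iff)
      then show ?thesis using mem[OF A] by blast
    qed
    show ?thesis using supp[OF s] supp[OF t] single by blast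
  qed
  obtain G where "?R \<noteq> {}" and G: "\<forall>g\<in>G. arc g" "?R = (\<Union>g\<in>G. path_image g)"
    using assms unfolding is_tree_def is_graph_def continuum_def by metis
  then obtain g where g: "arc g" "path_image g \<subseteq> ?R" by blast
  have "g 0 \<in> ?R" "g 1 \<in> ?R" using g(2) by (auto simp: path_image_def)
  then have "g 0 = g 1" using eq by blast
  then show False using g(1) unfolding arc_def inj_on_def by fastforce
qed

text \<open>
  If no member of \<open>\<A>\<close> meets one of \<open>\<B>\<close>, the support of a point lies on one side, so the total weight
  that a point puts on \<open>\<A>\<close> is a continuous function with values \<open>0\<close> and \<open>1\<close>, both attained.
\<close>

lemma realization_connected_imp_nerve_connected:
  assumes fin: "finite \<U>" and conn: "connected (geometric_realization (nerve \<U>))"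
    and AB: "\<U> = \<A> \<union> \<B>" and sep: "\<And>A B. A \<in> \<A> \<Longrightarrow> B \<in> \<B> \<Longrightarrow> A \<inter> B = {}"
    and A: "A \<in> \<A>" "A \<noteq> {}" and B: "B \<in> \<B>" "B \<noteq> {}"
  shows False
proof -
  let ?R = "geometric_realization (nerve \<U>)"
  have finA: "finite \<A>" using fin AB by simp
  define m where "m = (\<lambda>t :: 'a set \<Rightarrow> real. \<Sum>v\<in>\<A>. t v)"
  have "continuous_on ?R m"
    unfolding m_def by (intro continuous_on_sum continuous_on_coordinate)
  then have conm: "connected (m ` ?R)" using conn by (rule connected_continuous_image)
  have vals: "m t \<in> {0, 1}" if t: "t \<in> ?R" for t
  proof -
    note D = geometric_realizationD[OF t]
    let ?S = "{v. t v \<noteq> 0}"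
    have mt: "m t = sum t (\<A> \<inter> ?S)"
      unfolding m_def using finA by (intro sum.mono_neutral_right) auto
    have "?S \<subseteq> \<A> \<or> \<A> \<inter> ?S = {}"
    proof (rule ccontr)
      assume "\<not> ?thesis"
      then obtain C E where "C \<in> \<A>" "t C \<noteq> 0" "E \<notin> \<A>" "t E \<noteq> 0" by blast
      moreover from this have "E \<in> \<B>" using D(2)[of E] AB by blast
      ultimately show False using sep[of C E] D(4) by blast
    qed
    then show ?thesis
    proof
      assume "?S \<subseteq> \<A>"
      then have "\<A> \<inter> ?S = ?S" by blast
      then show ?thesis using mt D(5) by simp
    qed (simp add: mt)
  qed
  have BA: "B \<notin> \<A>" using sep[of B B] B by blast
  have "vertex A \<in> ?R" "vertex B \<in> ?R"
    using A B AB by (auto intro: vertex_in_realization)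
  moreover have "m (vertex A) = 1" "m (vertex B) = 0"
    using finA A(1) BA by (auto simp: m_def vertex_def sum.delta)
  ultimately have "1 \<in> m ` ?R" "0 \<in> m ` ?R" by force+
  then have "1/2 \<in> m ` ?R" using connectedD_interval[OF conm, of 0 1 "1/2"] by simp
  then show False using vals by fastforce
qed

text \<open>
  A product of uncountably many lines is not metrizable, but renumbering the finitely many relevant
  coordinates embeds \<open>S\<close> into the metrizable space of real sequences.
\<close>

lemma metrizable_finitely_supported:
  fixes S :: "('v \<Rightarrow> real) set"
  assumes S: "compact S" and F: "finite F" and supp: "\<And>t v. t \<in> S \<Longrightarrow> v \<notin> F \<Longrightarrow> t v = 0"
  shows "metrizable_space (top_of_set S)"
proof -
  obtain e :: "'v \<Rightarrow> nat" where e: "inj_on e F"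
    using finite_imp_inj_to_nat_seg[OF F] by blast
  define E where "E = (\<lambda>t n. if n \<in> e ` F then t (inv_into F e n) else (0::real))"
  have "continuous_on S E"
    unfolding E_def
  proof (rule continuous_on_coordinatewise_then_product)
    show "continuous_on S (\<lambda>t. if n \<in> e ` F then t (inv_into F e n) else 0)" for n
      by (intro continuous_on_if_const continuous_on_coordinate continuous_on_const)
  qed
  moreover have "inj_on E S"
  proof (rule inj_onI, rule ext)
    fix s t v assume s: "s \<in> S" and t: "t \<in> S" and eq: "E s = E t"
    show "s v = t v"
    proof (cases "v \<in> F")
      case True
      then show ?thesis using fun_cong[OF eq, of "e v"] e by (simp add: E_def)
    next
      case False
      then show ?thesis using supp[OF s] supp[OF t] by simp
    qed
  qed
  ultimately obtain g where "homeomorphism S (E ` S) E g"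
    using homeomorphism_compact[OF S] by blast
  then have "top_of_set S homeomorphic_space top_of_set (E ` S)"
    unfolding homeomorphic_space_def homeomorphic_maps_def homeomorphism_def
    by (metis continuous_map_iff_continuous continuous_map_into_subtopology order_refl
        topspace_euclidean_subtopology image_subset_iff_funcset)
  moreover have "metrizable_space (top_of_set (E ` S))"
    by (intro metrizable_space_subtopology metrizable_space_euclidean)
  ultimately show ?thesis using homeomorphic_metrizable_space by blast
qed

section \<open>Covers of connected sets with a tree as nerve\<close>

text \<open>
  Otherwise the parts of \<open>X\<close> covered by \<open>\<C>\<close> and by its complement in \<open>\<W>\<close> would disconnect \<open>X\<close>.
\<close>

lemma connected_cover_meets:
  assumes X: "connected X" and cov: "X \<subseteq> \<Union>\<W>"
    and opn: "\<And>W. W \<in> \<W> \<Longrightarrow> openin (top_of_set X) (X \<inter> W)"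
    and meets: "\<And>W. W \<in> \<W> \<Longrightarrow> X \<inter> W \<noteq> {}"
    and ne: "\<C> \<subseteq> \<W>" "\<C> \<noteq> {}" "\<C> \<noteq> \<W>"
  obtains C D where "C \<in> \<C>" "D \<in> \<W>" "D \<notin> \<C>" "C \<inter> D \<noteq> {}"
proof (rule ccontr)
  assume "\<not> thesis"
  with that have dis: "C \<inter> D = {}" if "C \<in> \<C>" "D \<in> \<W> - \<C>" for C D
    using that by blast
  define P Q where "P = (\<Union>C\<in>\<C>. X \<inter> C)" and "Q = (\<Union>D\<in>\<W> - \<C>. X \<inter> D)"
  have "openin (top_of_set X) P" "openin (top_of_set X) Q"
    unfolding P_def Q_def by (rule openin_Union; use opn ne(1) in blast)+
  moreover have "X \<subseteq> P \<union> Q" unfolding P_def Q_def using cov by blast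
  moreover have "P \<inter> Q = {}" unfolding P_def Q_def using dis by blast
  moreover have "P \<noteq> {}" "Q \<noteq> {}" unfolding P_def Q_def using meets ne by blast+
  ultimately show False using X unfolding connected_openin by metis
qed

text \<open>
  Without triangles a support has at most two elements, and a vertex lies on an edge to a neighbour.
\<close>

lemma realization_point_on_edge:
  assumes ne: "{} \<notin> \<W>"
    and nbr: "\<And>A. A \<in> \<W> \<Longrightarrow> \<exists>B\<in>\<W>. B \<noteq> A \<and> A \<inter> B \<noteq> {}"
    and tri: "\<And>A B C. A \<in> \<W> \<Longrightarrow> B \<in> \<W> \<Longrightarrow> C \<in> \<W> \<Longrightarrow> A \<noteq> B \<Longrightarrow> B \<noteq> C \<Longrightarrow> A \<noteq> C \<Longrightarrow>
      A \<inter> B \<noteq> {} \<Longrightarrow> B \<inter> C \<noteq> {} \<Longrightarrow> A \<inter> C \<noteq> {} \<Longrightarrow> False"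
    and t: "t \<in> geometric_realization (nerve \<W>)"
  obtains A B s where "A \<in> \<W>" "B \<in> \<W>" "A \<noteq> B" "A \<inter> B \<noteq> {}" "0 \<le> s" "s \<le> 1"
    "t = edge_path A B s"
proof -
  note D = geometric_realizationD[OF t]
  let ?S = "{v. t v \<noteq> 0}"
  have mem: "v \<in> \<W>" if "t v \<noteq> 0" for v using D(2) that by blast
  have int: "v \<inter> w \<noteq> {}" if "t v \<noteq> 0" "t w \<noteq> 0" for v w using D(4) that by blast
  obtain A where A: "t A \<noteq> 0"
    using D(5) by (metis (mono_tags, lifting) mem_Collect_eq sum.neutral zero_neq_one)
  show thesis
  proof (cases "?S = {A}")
    case True
    then have "t A = 1" using D(5) by simp
    then have "t = edge_path A B 0" for B using True by (auto simp: vertex_def fun_eq_iff)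
    then show thesis using that mem[OF A] nbr[OF mem[OF A]] by (metis order_refl zero_le_one)
  next
    case False
    then obtain B where B: "t B \<noteq> 0" "B \<noteq> A" using A by blast
    have S: "?S = {A, B}"
    proof (rule ccontr)
      assume "?S \<noteq> {A, B}"
      then obtain C where "t C \<noteq> 0" "C \<noteq> A" "C \<noteq> B" using A B by blast
      then show False using tri[of A B C] A B mem int by blast
    qed
    then have "t A + t B = 1" using D(5) B(2) by simp
    then have "t = edge_path A B (t B)" using S by (auto simp: edge_path_def fun_eq_iff)
    moreover have "0 \<le> t B" "t B \<le> 1" using D(1)[of A] D(1)[of B] \<open>t A + t B = 1\<close> by auto
    ultimately show thesis using that A B mem int by metis
  qed
qed

text \<open>
  The nerve of \<open>\<W>\<close> embeds into that of \<open>\<V>\<close> by \<open>h\<close>. A subcomplex of a tree can fail to be a tree only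
  by being disconnected or a single point, and the connected set \<open>X\<close> covered by \<open>\<W>\<close> excludes the
  former. Triangles and simple closed curves for \<open>\<W>\<close> would be carried to such for \<open>\<V>\<close>, as \<open>h\<close>
  preserves intersections and induces an injective continuous map of realizations.
\<close>

lemma is_tree_nerve_of_connected_cover:
  fixes \<W> :: "'a::topological_space set set" and \<V> :: "'b set set"
  assumes tree: "is_tree (geometric_realization (nerve \<V>))"
    and h: "h \<in> \<W> \<rightarrow> \<V>" "inj_on h \<W>"
    and hint: "\<And>A B. A \<in> \<W> \<Longrightarrow> B \<in> \<W> \<Longrightarrow> A \<inter> B \<noteq> {} \<Longrightarrow> h A \<inter> h B \<noteq> {}"
    and fin: "finite \<W>" and two: "A0 \<in> \<W>" "B0 \<in> \<W>" "A0 \<noteq> B0"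
    and X: "connected X" and cov: "X \<subseteq> \<Union>\<W>"
    and opn: "\<And>W. W \<in> \<W> \<Longrightarrow> openin (top_of_set X) (X \<inter> W)"
    and meets: "\<And>W. W \<in> \<W> \<Longrightarrow> X \<inter> W \<noteq> {}"
  shows "is_tree (geometric_realization (nerve \<W>))"
proof -
  let ?R = "geometric_realization (nerve \<W>)"
  have ne: "{} \<notin> \<W>" using meets by blast
  have nbr: "\<exists>B\<in>\<W>. B \<noteq> A \<and> A \<inter> B \<noteq> {}" if A: "A \<in> \<W>" for A
  proof -
    have "{A} \<noteq> \<W>" using two by blast
    then show ?thesis
      using connected_cover_meets[OF X cov opn meets, of "{A}"] A by (metis empty_subsetI insert_subset insert_not_empty singletonD singletonI)
  qed
  have tri: False if "A \<in> \<W>" "B \<in> \<W>" "C \<in> \<W>" "A \<noteq> B" "B \<noteq> C" "A \<noteq> C"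
      "A \<inter> B \<noteq> {}" "B \<inter> C \<noteq> {}" "A \<inter> C \<noteq> {}" for A B C
  proof (rule tree_realization_no_triangle[OF tree])
    show "h A \<in> \<V>" "h B \<in> \<V>" "h C \<in> \<V>" using h(1) that by auto
    show "h A \<noteq> h B" "h B \<noteq> h C" "h A \<noteq> h C" using h(2) that unfolding inj_on_def by blast+
    show "h A \<inter> h B \<noteq> {}" "h B \<inter> h C \<noteq> {}" "h A \<inter> h C \<noteq> {}" using hint that by blast+
  qed
  have edges: thesis
    if "t \<in> ?R" and "\<And>A B s. A \<in> \<W> \<Longrightarrow> B \<in> \<W> \<Longrightarrow> A \<noteq> B \<Longrightarrow> A \<inter> B \<noteq> {} \<Longrightarrow> 0 \<le> s \<Longrightarrow> s \<le> 1 \<Longrightarrow>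
      t = edge_path A B s \<Longrightarrow> thesis" for t thesis
  proof (rule realization_point_on_edge[OF ne nbr _ that(1)])
    show False if "A \<in> \<W>" "B \<in> \<W>" "C \<in> \<W>" "A \<noteq> B" "B \<noteq> C" "A \<noteq> C"
      "A \<inter> B \<noteq> {}" "B \<inter> C \<noteq> {}" "A \<inter> C \<noteq> {}" for A B C
      using tri that .
  qed (use that(2) in blast)+
  \<comment> \<open>An arbitrary linear order of \<open>\<W>\<close> selects one of the two orientations of each edge.\<close>
  obtain e :: "'a set \<Rightarrow> nat" where e: "inj_on e \<W>"
    using finite_imp_inj_to_nat_seg[OF fin] by blast
  define P where "P = {(A, B). A \<in> \<W> \<and> B \<in> \<W> \<and> e A < e B \<and> A \<inter> B \<noteq> {}}"
  define G where "G = (\<lambda>(A, B). edge_path A B) ` P"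
  have "P \<subseteq> \<W> \<times> \<W>" by (auto simp: P_def)
  then have finG: "finite G" unfolding G_def using fin by (meson finite_SigmaI finite_imageI finite_subset)
  have arcG: "\<forall>g\<in>G. arc g" by (auto simp: G_def P_def intro!: arc_edge_path)
  have RG: "?R = (\<Union>g\<in>G. path_image g)"
  proof (intro subset_antisym subsetI)
    fix t assume "t \<in> ?R"
    then obtain A B s where AB: "A \<in> \<W>" "B \<in> \<W>" "A \<noteq> B" "A \<inter> B \<noteq> {}" "0 \<le> s" "s \<le> 1"
        "t = edge_path A B s" by (rule edges)
    then have "e A \<noteq> e B" using e unfolding inj_on_def by blast
    then consider "(A, B) \<in> P" | "(B, A) \<in> P" using AB by (force simp: P_def)
    then show "t \<in> (\<Union>g\<in>G. path_image g)"
    proof cases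
      case 1
      then have "edge_path A B \<in> G" by (force simp: G_def)
      moreover have "s \<in> {0..1}" using AB by simp
      ultimately show ?thesis using AB(7) unfolding path_image_def by blast
    next
      case 2
      then have "edge_path B A \<in> G" by (force simp: G_def)
      moreover have "t = edge_path B A (1 - s)" using AB by (auto simp: edge_path_def fun_eq_iff)
      moreover have "1 - s \<in> {0..1}" using AB by simp
      ultimately show ?thesis unfolding path_image_def by blast
    qed
  next
    fix t assume "t \<in> (\<Union>g\<in>G. path_image g)"
    then show "t \<in> ?R" unfolding G_def P_def using edge_in_realization[of _ \<W>] by fastforce
  qed
  have meetG: "pairwise (\<lambda>g k. path_image g \<inter> path_image k \<subseteq>
      {pathstart g, pathfinish g} \<inter> {pathstart k, pathfinish k}) G"
  proof (rule pairwiseI, rule subsetI)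
    fix g k t assume gk: "g \<in> G" "k \<in> G" "g \<noteq> k" and t: "t \<in> path_image g \<inter> path_image k"
    obtain A B where AB: "(A, B) \<in> P" "g = edge_path A B" using gk by (auto simp: G_def)
    obtain C D where CD: "(C, D) \<in> P" "k = edge_path C D" using gk by (auto simp: G_def)
    have "(A, B) \<noteq> (C, D)" using gk AB CD by auto
    then have dif: "{A, B} \<noteq> {C, D}"
      using AB(1) CD(1) unfolding P_def doubleton_eq_iff by auto
    obtain s where s: "0 \<le> s" "s \<le> 1" "t = edge_path A B s"
      using t AB by (auto simp: path_image_def)
    obtain r where r: "0 \<le> r" "r \<le> 1" "t = edge_path C D r"
      using t CD by (auto simp: path_image_def)
    have neq: "A \<noteq> B" "C \<noteq> D" using AB CD by (auto simp: P_def)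
    have "s = 0 \<or> s = 1"
    proof (rule ccontr)
      assume "\<not> ?thesis"
      then have "t A \<noteq> 0" "t B \<noteq> 0" using s neq by (auto simp: edge_path_def)
      then have "A \<in> {C, D}" "B \<in> {C, D}" using r by (auto simp: edge_path_def split: if_splits)
      then show False using dif neq by blast
    qed
    moreover have "r = 0 \<or> r = 1"
    proof (rule ccontr)
      assume "\<not> ?thesis"
      then have "t C \<noteq> 0" "t D \<noteq> 0" using r neq by (auto simp: edge_path_def)
      then have "C \<in> {A, B}" "D \<in> {A, B}" using s by (auto simp: edge_path_def split: if_splits)
      then show False using dif neq by blast
    qed
    ultimately show "t \<in> {pathstart g, pathfinish g} \<inter> {pathstart k, pathfinish k}"
      using s(3) r(3) AB(2) CD(2) unfolding pathstart_def pathfinish_def by blast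
  qed
  have "continuum ?R"
    unfolding continuum_def
  proof (intro conjI)
    show "?R \<noteq> {}" using vertex_in_realization[OF two(1)] two(1) ne by blast
    show cpt: "compact ?R"
      unfolding RG using finG arcG by (intro compact_UN) (auto intro: compact_path_image arc_imp_path)
    show "metrizable_space (top_of_set ?R)"
      using metrizable_finitely_supported[OF cpt fin] geometric_realizationD(2) by blast
    have step: "connected_component ?R (edge_path A B s) (edge_path A B r)"
      if "A \<in> \<W>" "B \<in> \<W>" "A \<noteq> B" "A \<inter> B \<noteq> {}" "s \<in> {0..1}" "r \<in> {0..1}" for A B s r
    proof -
      have "connected (path_image (edge_path A B))"
        using arc_edge_path[OF that(3)] by (simp add: connected_path_image arc_imp_path)
      moreover have "edge_path A B s \<in> path_image (edge_path A B)"
        "edge_path A B r \<in> path_image (edge_path A B)"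
        using that(5,6) unfolding path_image_def by blast+
      ultimately show ?thesis
        unfolding connected_component_def using edge_in_realization[OF that(1-4)] by blast
    qed
    \<comment> \<open>The vertices reachable from \<open>A0\<close>; they are all of them because \<open>X\<close> is connected.\<close>
    define \<C> where "\<C> = {W \<in> \<W>. connected_component ?R (vertex A0) (vertex W)}"
    have A0: "A0 \<in> \<C>"
      using two(1) ne vertex_in_realization[of A0 \<W>] by (auto simp: \<C>_def)
    have "\<C> = \<W>"
    proof (rule ccontr)
      assume "\<C> \<noteq> \<W>"
      moreover have sub: "\<C> \<subseteq> \<W>" by (auto simp: \<C>_def)
      moreover have "\<C> \<noteq> {}" using A0 by blast
      ultimately obtain C D where CD: "C \<in> \<C>" "D \<in> \<W>" "D \<notin> \<C>" "C \<inter> D \<noteq> {}"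
        using connected_cover_meets[OF X cov opn meets, of \<C>] by metis
      then have "C \<in> \<W>" "C \<noteq> D" using sub by auto
      then have "connected_component ?R (vertex C) (vertex D)"
        using step[of C D 0 1] CD by simp
      moreover have "connected_component ?R (vertex A0) (vertex C)"
        using CD(1) by (simp add: \<C>_def)
      ultimately have "connected_component ?R (vertex A0) (vertex D)"
        using connected_component_trans by metis
      then show False using CD(2,3) by (simp add: \<C>_def)
    qed
    have "connected_component ?R (vertex A0) t" if t: "t \<in> ?R" for t
    proof -
      obtain A B s where AB: "A \<in> \<W>" "B \<in> \<W>" "A \<noteq> B" "A \<inter> B \<noteq> {}" "0 \<le> s" "s \<le> 1"
        "t = edge_path A B s" using t by (rule edges)
      then have "connected_component ?R (vertex A) t" using step[of A B 0 s] by simp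
      moreover have "A \<in> \<C>" using \<open>\<C> = \<W>\<close> AB(1) by simp
      ultimately show ?thesis
        using connected_component_trans unfolding \<C>_def by blast
    qed
    then show "connected ?R"
      unfolding connected_iff_connected_component
      by (meson connected_component_sym connected_component_trans)
  qed
  then have graph: "is_graph ?R"
    unfolding is_graph_def using finG arcG RG meetG by blast
  \<comment> \<open>The map of realizations induced by \<open>h\<close>; it carries loops to loops.\<close>
  define H where "H = (\<lambda>t V. if V \<in> h ` \<W> then t (inv_into \<W> h V) else (0::real))"
  have Hedge: "H (edge_path A B s) = edge_path (h A) (h B) s" if "A \<in> \<W>" "B \<in> \<W>" "A \<noteq> B" for A B s
    using that h(2) by (auto simp: H_def edge_path_def fun_eq_iff inj_on_eq_iff)
  have contH: "continuous_on S H" for S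
    unfolding H_def
    by (intro continuous_on_coordinatewise_then_product continuous_on_if_const
        continuous_on_coordinate continuous_on_const)
  have injH: "inj_on H ?R"
  proof (rule inj_onI, rule ext)
    fix s t W assume s: "s \<in> ?R" and t: "t \<in> ?R" and eq: "H s = H t"
    show "s W = t W"
    proof (cases "W \<in> \<W>")
      case True
      then show ?thesis using fun_cong[OF eq, of "h W"] h(2) by (simp add: H_def)
    next
      case False
      then show ?thesis using s t by (simp add: geometric_realizationD(2))
    qed
  qed
  have HR: "H t \<in> geometric_realization (nerve \<V>)" if t: "t \<in> ?R" for t
  proof -
    obtain A B s where AB: "A \<in> \<W>" "B \<in> \<W>" "A \<noteq> B" "A \<inter> B \<noteq> {}" "0 \<le> s" "s \<le> 1"
        "t = edge_path A B s" using t by (rule edges)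
    have "h A \<in> \<V>" "h B \<in> \<V>" "h A \<noteq> h B" "h A \<inter> h B \<noteq> {}"
      using AB h hint by (auto simp: inj_on_eq_iff)
    then have "path_image (edge_path (h A) (h B)) \<subseteq> geometric_realization (nerve \<V>)"
      by (rule edge_in_realization)
    moreover have "s \<in> {0..1}" using AB by simp
    ultimately show ?thesis
      unfolding AB(7) Hedge[OF AB(1-3)] path_image_def by blast
  qed
  have "\<not> (simple_path g \<and> pathfinish g = pathstart g \<and> path_image g \<subseteq> ?R)" for g
  proof
    assume g: "simple_path g \<and> pathfinish g = pathstart g \<and> path_image g \<subseteq> ?R"
    then have "simple_path (H \<circ> g)"
      using simple_path_continuous_image[OF _ contH inj_on_subset[OF injH]] by blast
    moreover have "pathfinish (H \<circ> g) = pathstart (H \<circ> g)"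
      using g by (simp add: pathfinish_compose pathstart_compose)
    moreover have "path_image (H \<circ> g) \<subseteq> geometric_realization (nerve \<V>)"
      using g HR unfolding path_image_compose by blast
    ultimately show False using tree unfolding is_tree_def by blast
  qed
  then show ?thesis using graph unfolding is_tree_def by blast
qed

lemma Lebesgue_number_openin:
  fixes X :: "'a::metric_space set"
  assumes X: "compact X" and opn: "\<And>V. V \<in> \<O> \<Longrightarrow> openin (top_of_set X) V" and cov: "X \<subseteq> \<Union>\<O>"
  obtains \<epsilon> where "0 < \<epsilon>" "\<And>x. x \<in> X \<Longrightarrow> \<exists>V\<in>\<O>. X \<inter> ball x \<epsilon> \<subseteq> V"
proof -
  define \<G> where "\<G> = {G. open G \<and> X \<inter> G \<in> \<O>}"
  have opG: "open G" if "G \<in> \<G>" for G using that by (simp add: \<G>_def)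
  have XG: "X \<subseteq> \<Union>\<G>"
  proof
    fix x assume "x \<in> X"
    then obtain V where V: "V \<in> \<O>" "x \<in> V" using cov by blast
    then obtain T where "open T" "V = X \<inter> T" using opn by (meson openin_open)
    then show "x \<in> \<Union>\<G>" using V by (auto simp: \<G>_def)
  qed
  obtain \<epsilon> where \<epsilon>: "0 < \<epsilon>" "\<And>x. x \<in> X \<Longrightarrow> \<exists>G\<in>\<G>. ball x \<epsilon> \<subseteq> G"
    using Heine_Borel_lemma[OF X XG opG] by metis
  have "\<exists>V\<in>\<O>. X \<inter> ball x \<epsilon> \<subseteq> V" if x: "x \<in> X" for x
  proof -
    obtain G where "G \<in> \<G>" "ball x \<epsilon> \<subseteq> G" using \<epsilon>(2)[OF x] by blast
    then show ?thesis unfolding \<G>_def by blast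
  qed
  with \<epsilon>(1) show thesis by (rule that)
qed

lemma mesh_less_dist:
  assumes "mesh \<U> < ennreal e" "U \<in> \<U>" "x \<in> U" "y \<in> U"
  shows "dist x y < e"
proof -
  have "ennreal (dist x y) \<le> (SUP (x, y)\<in>U \<times> U. ennreal (dist x y))"
    using assms by (intro SUP_upper2[of "(x, y)"]) auto
  also have "\<dots> \<le> mesh \<U>" unfolding mesh_def using assms(2) by (rule SUP_upper)
  also have "\<dots> < ennreal e" by fact
  finally show ?thesis by (simp add: ennreal_less_iff)
qed

lemma mesh_leI:
  assumes "\<And>U x y. U \<in> \<U> \<Longrightarrow> x \<in> U \<Longrightarrow> y \<in> U \<Longrightarrow> dist x y \<le> e"
  shows "mesh \<U> \<le> ennreal e"
  unfolding mesh_def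
proof (intro SUP_least)
  fix U p assume "U \<in> \<U>" "p \<in> U \<times> U"
  then show "(case p of (x, y) \<Rightarrow> ennreal (dist x y)) \<le> ennreal e"
    using assms[of U "fst p" "snd p"] by (simp add: case_prod_beta mem_Times_iff ennreal_leI)
qed

section \<open>The intersection of a sequence of tree-chains\<close>

text \<open>
  A bounded set has compact closure here, so the closures of the unions \<open>\<Union>(\<U> n)\<close> are eventually a
  nested sequence of compact sets.
\<close>

locale shrinking_tree_chains =
  fixes \<U> :: "nat \<Rightarrow> 'a::heine_borel set set"
  assumes chain: "n \<ge> 1 \<Longrightarrow> tree_chain (\<U> n)"
    and refine: "n \<ge> 1 \<Longrightarrow> strongly_refines (\<U> (n + 1)) (\<U> n)"
    and mesh: "(\<lambda>n. mesh (\<U> n)) \<longlonglongrightarrow> 0"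
begin

definition X where "X = (\<Inter>n\<in>{1..}. \<Union>(\<U> n))"

lemma finite_chain: "n \<ge> 1 \<Longrightarrow> finite (\<U> n)"
  and open_chain: "n \<ge> 1 \<Longrightarrow> U \<in> \<U> n \<Longrightarrow> open U"
  and tree_nerve: "n \<ge> 1 \<Longrightarrow> is_tree (geometric_realization (nerve (\<U> n)))"
  using chain by (auto simp: tree_chain_def)

lemma eventually_small:
  assumes "0 < e"
  obtains N where "N \<ge> 1" "\<And>n U x y. n \<ge> N \<Longrightarrow> U \<in> \<U> n \<Longrightarrow> x \<in> U \<Longrightarrow> y \<in> U \<Longrightarrow> dist x y < e"
proof -
  have "eventually (\<lambda>n. mesh (\<U> n) < ennreal e) sequentially"
    using order_tendstoD(2)[OF mesh, of "ennreal e"] assms by simp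
  then obtain N where N: "\<And>n. n \<ge> N \<Longrightarrow> mesh (\<U> n) < ennreal e"
    unfolding eventually_sequentially by blast
  show thesis
  proof (rule that[of "max N 1"])
    show "dist x y < e" if "n \<ge> max N 1" "U \<in> \<U> n" "x \<in> U" "y \<in> U" for n U x y
      using mesh_less_dist[OF N that(2-4)] that(1) by simp
  qed simp
qed

lemma small_stage:
  assumes "0 < e"
  obtains n where "n \<ge> 1" "\<And>U x y. U \<in> \<U> n \<Longrightarrow> x \<in> U \<Longrightarrow> y \<in> U \<Longrightarrow> dist x y < e"
proof -
  obtain N where "N \<ge> 1" "\<And>n U x y. n \<ge> N \<Longrightarrow> U \<in> \<U> n \<Longrightarrow> x \<in> U \<Longrightarrow> y \<in> U \<Longrightarrow> dist x y < e"
    using eventually_small[OF assms] by metis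
  then show thesis using that[of N] by blast
qed

lemma closure_Union_Suc:
  assumes "n \<ge> 1"
  shows "closure (\<Union>(\<U> (Suc n))) \<subseteq> \<Union>(\<U> n)"
proof -
  have "closed (\<Union>U\<in>\<U> (Suc n). closure U)"
    using finite_chain[of "Suc n"] by (intro closed_UN) auto
  moreover have "\<Union>(\<U> (Suc n)) \<subseteq> (\<Union>U\<in>\<U> (Suc n). closure U)"
    using closure_subset by blast
  ultimately have "closure (\<Union>(\<U> (Suc n))) \<subseteq> (\<Union>U\<in>\<U> (Suc n). closure U)"
    by (rule closure_minimal[rotated])
  also have "\<dots> \<subseteq> \<Union>(\<U> n)"
    using refine[OF assms] unfolding strongly_refines_def by fastforce
  finally show ?thesis .
qed

lemma Union_antimono:
  assumes "1 \<le> m" "m \<le> n"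
  shows "\<Union>(\<U> n) \<subseteq> \<Union>(\<U> m)"
  using assms(2)
proof (induction n rule: dec_induct)
  case (step n)
  have "\<Union>(\<U> (Suc n)) \<subseteq> \<Union>(\<U> n)"
    using closure_Union_Suc[of n] closure_subset step(1) assms(1) by (meson order_trans)
  then show ?case using step by blast
qed simp

text \<open>
  Strong refinement makes each union contain the closure of the next one, so passing to closures does
  not change the intersection. The shift by \<open>N\<close> skips the stages that may be unbounded.
\<close>

lemma limit_compact_tail:
  obtains N where "N \<ge> 1" "\<And>n. compact (closure (\<Union>(\<U> (n + N))))"
    "\<And>n. closure (\<Union>(\<U> (n + N))) \<noteq> {}"
    "\<And>m n. m \<le> n \<Longrightarrow> closure (\<Union>(\<U> (n + N))) \<subseteq> closure (\<Union>(\<U> (m + N)))"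
    "X = (\<Inter>n. closure (\<Union>(\<U> (n + N))))"
proof -
  obtain N where N: "N \<ge> 1"
      "\<And>n U x y. n \<ge> N \<Longrightarrow> U \<in> \<U> n \<Longrightarrow> x \<in> U \<Longrightarrow> y \<in> U \<Longrightarrow> dist x y < 1"
    using eventually_small[of 1] by auto
  show thesis
  proof (rule that[OF N(1)])
    fix n
    have "bounded U" if "U \<in> \<U> (n + N)" for U
    proof (cases "U = {}")
      case False
      then obtain x where "x \<in> U" by blast
      then have "\<forall>y\<in>U. dist x y \<le> 1" using N(2)[of "n + N" U x] that by fastforce
      then show ?thesis unfolding bounded_def by blast
    qed simp
    then have "bounded (\<Union>(\<U> (n + N)))" using finite_chain[of "n + N"] N(1) by (intro bounded_Union) auto
    then show "compact (closure (\<Union>(\<U> (n + N))))" by simp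
    obtain A where "A \<in> \<U> (n + N)" "A \<noteq> {}"
      using tree_realization_two_vertices[OF tree_nerve[of "n + N"]] N(1) by auto
    then show "closure (\<Union>(\<U> (n + N))) \<noteq> {}" by auto
  next
    show "closure (\<Union>(\<U> (n + N))) \<subseteq> closure (\<Union>(\<U> (m + N)))" if "m \<le> n" for m n
      using that N(1) by (intro closure_mono Union_antimono) auto
  next
    have "X \<subseteq> closure (\<Union>(\<U> (n + N)))" for n
      using closure_subset[of "\<Union>(\<U> (n + N))"] N(1) by (force simp: X_def)
    moreover have "(\<Inter>n. closure (\<Union>(\<U> (n + N)))) \<subseteq> \<Union>(\<U> m)" if "m \<ge> 1" for m
    proof -
      have "(\<Inter>n. closure (\<Union>(\<U> (n + N)))) \<subseteq> closure (\<Union>(\<U> (Suc m + N)))" by blast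
      also have "\<dots> \<subseteq> \<Union>(\<U> (m + N))" using closure_Union_Suc[of "m + N"] N(1) by simp
      also have "\<dots> \<subseteq> \<Union>(\<U> m)" using Union_antimono[of m "m + N"] that by simp
      finally show ?thesis .
    qed
    ultimately show "X = (\<Inter>n. closure (\<Union>(\<U> (n + N))))" unfolding X_def by blast
  qed
qed

lemma compact_X: "compact X"
proof -
  obtain N where N: "\<And>n. compact (closure (\<Union>(\<U> (n + N))))" "X = (\<Inter>n. closure (\<Union>(\<U> (n + N))))"
    using limit_compact_tail by metis
  have "closed X" unfolding N(2) by blast
  moreover have "X = closure (\<Union>(\<U> (0 + N))) \<inter> X" unfolding N(2) by blast
  ultimately show ?thesis using compact_Int_closed[OF N(1)[of 0]] by metis
qed

lemma nonempty_X: "X \<noteq> {}"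
proof -
  obtain N where "\<And>n. compact (closure (\<Union>(\<U> (n + N))))"
    "\<And>n. closure (\<Union>(\<U> (n + N))) \<noteq> {}"
    "\<And>m n. m \<le> n \<Longrightarrow> closure (\<Union>(\<U> (n + N))) \<subseteq> closure (\<Union>(\<U> (m + N)))"
    "X = (\<Inter>n. closure (\<Union>(\<U> (n + N))))"
    using limit_compact_tail by metis
  then show ?thesis using compact_nest[of "\<lambda>n. closure (\<Union>(\<U> (n + N)))"] by simp
qed

text \<open>
  Otherwise the parts of the compact closures outside \<open>G\<close> would be a nested sequence of nonempty
  compact sets, with a common point in \<open>X - G\<close>.
\<close>

lemma eventually_near_X:
  assumes "open G" "X \<subseteq> G"
  obtains M where "M \<ge> 1" "\<And>n. n \<ge> M \<Longrightarrow> \<Union>(\<U> n) \<subseteq> G"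
proof -
  obtain N where N: "N \<ge> 1" "\<And>n. compact (closure (\<Union>(\<U> (n + N))))"
    "\<And>m n. m \<le> n \<Longrightarrow> closure (\<Union>(\<U> (n + N))) \<subseteq> closure (\<Union>(\<U> (m + N)))"
    "X = (\<Inter>n. closure (\<Union>(\<U> (n + N))))"
    using limit_compact_tail by metis
  define F where "F n = closure (\<Union>(\<U> (n + N))) - G" for n
  have "\<exists>n. F n = {}"
  proof (rule ccontr)
    assume ne: "\<nexists>n. F n = {}"
    have "compact (F n)" for n unfolding F_def using N(2) assms(1) by (rule compact_diff)
    moreover have "F n \<subseteq> F m" if "m \<le> n" for m n unfolding F_def using N(3)[OF that] by blast
    ultimately have "\<Inter>(range F) \<noteq> {}" using ne compact_nest[of F] by metis
    moreover have "\<Inter>(range F) \<subseteq> X - G" unfolding F_def N(4) by blast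
    ultimately show False using assms(2) by blast
  qed
  then obtain n where n: "F n = {}" by blast
  show thesis
  proof (rule that[of "n + N"])
    show "n + N \<ge> 1" using N(1) by simp
    fix k assume "k \<ge> n + N"
    then have "\<Union>(\<U> k) \<subseteq> \<Union>(\<U> (n + N))" using Union_antimono[of "n + N" k] N(1) by simp
    also have "\<dots> \<subseteq> closure (\<Union>(\<U> (n + N)))" by (rule closure_subset)
    also have "\<dots> \<subseteq> G" using n by (auto simp: F_def)
    finally show "\<Union>(\<U> k) \<subseteq> G" .
  qed
qed

text \<open>
  The members of a tree-chain may be disconnected, and so may its union; only the nerve is
  connected. If \<open>X\<close> split into two compact pieces, then a stage that is close to \<open>X\<close> and
  whose members are small compared with the gap would split into the members near one piece and
  those near the other, and its nerve would be disconnected.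
\<close>

lemma connected_X: "connected X"
proof (rule ccontr)
  assume "\<not> connected X"
  then obtain A B where AB: "closed A" "closed B" "A \<noteq> {}" "B \<noteq> {}" "A \<union> B = X" "A \<inter> B = {}"
    using connected_closed_set[OF compact_imp_closed[OF compact_X]] by blast
  have "X \<inter> A = A" using AB(5) by blast
  then have "compact A" using compact_Int_closed[OF compact_X AB(1)] by simp
  then obtain d where d: "0 < d" "\<And>x y. x \<in> A \<Longrightarrow> y \<in> B \<Longrightarrow> d \<le> dist x y"
    using separate_compact_closed AB(2,6) by metis
  let ?A = "\<Union>x\<in>A. ball x (d/3)" and ?B = "\<Union>x\<in>B. ball x (d/3)"
  have "X \<subseteq> ?A \<union> ?B" unfolding AB(5)[symmetric] using d(1) by fastforce
  then obtain M where M: "M \<ge> 1" "\<And>n. n \<ge> M \<Longrightarrow> \<Union>(\<U> n) \<subseteq> ?A \<union> ?B"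
    using eventually_near_X[of "?A \<union> ?B"] by blast
  obtain N where N: "N \<ge> 1"
      "\<And>n U x y. n \<ge> N \<Longrightarrow> U \<in> \<U> n \<Longrightarrow> x \<in> U \<Longrightarrow> y \<in> U \<Longrightarrow> dist x y < d/3"
    using eventually_small[of "d/3"] d(1) by auto
  define n where "n = max M N"
  have n: "n \<ge> 1" "\<Union>(\<U> n) \<subseteq> ?A \<union> ?B" "\<And>U x y. U \<in> \<U> n \<Longrightarrow> x \<in> U \<Longrightarrow> y \<in> U \<Longrightarrow> dist x y < d/3"
    using M(1) M(2)[of n] N(2)[of n] unfolding n_def by simp_all
  have far: False if U: "U \<in> \<U> n" "x \<in> U" "y \<in> U" and xy: "x \<in> ?A" "y \<in> ?B" for U x y
  proof -
    obtain a b where "a \<in> A" "dist a x < d/3" "b \<in> B" "dist b y < d/3" using xy by auto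
    moreover have "dist a b \<le> dist a x + dist x y + dist b y" by metric
    ultimately show False using d(2)[of a b] n(3)[OF U] by linarith
  qed
  define \<A> where "\<A> = {U \<in> \<U> n. U \<inter> ?A \<noteq> {}}"
  have XU: "X \<subseteq> \<Union>(\<U> n)" using n(1) by (auto simp: X_def)
  obtain a where a: "a \<in> A" "a \<in> ?A" using AB(3) d(1) by fastforce
  obtain b where b: "b \<in> B" "b \<in> ?B" using AB(4) d(1) by fastforce
  obtain UA where UA: "UA \<in> \<U> n" "a \<in> UA" using XU AB(5) a by blast
  obtain UB where UB: "UB \<in> \<U> n" "b \<in> UB" using XU AB(5) b by blast
  show False
  proof (rule realization_connected_imp_nerve_connected[of "\<U> n" \<A> "\<U> n - \<A>" UA UB])
    show "finite (\<U> n)" using finite_chain n(1) by simp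
    show "connected (geometric_realization (nerve (\<U> n)))"
      using tree_nerve[OF n(1)] by (simp add: is_tree_def is_graph_def continuum_def)
    show "\<U> n = \<A> \<union> (\<U> n - \<A>)" by (auto simp: \<A>_def)
    show "U \<inter> V = {}" if "U \<in> \<A>" "V \<in> \<U> n - \<A>" for U V
    proof (rule ccontr)
      assume "U \<inter> V \<noteq> {}"
      then obtain z where z: "z \<in> U" "z \<in> V" by blast
      have "U \<in> \<U> n" and "\<exists>x. x \<in> U \<and> x \<in> ?A" using that by (auto simp: \<A>_def)
      moreover have "V \<inter> ?A = {}" using that by (simp add: \<A>_def)
      then have "z \<notin> ?A" using z by blast
      then have "z \<in> ?B" using n(2) z that by blast
      ultimately show False using far z(1) by blast
    qed
    have "UA \<inter> ?A \<noteq> {}" using UA a by blast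
    then show "UA \<in> \<A>" "UA \<noteq> {}" using UA by (auto simp only: \<A>_def mem_Collect_eq)
    show "UB \<noteq> {}" using UB by blast
    have "UB \<inter> ?A = {}" using far[OF UB(1) _ UB(2) _ b(2)] by blast
    then show "UB \<in> \<U> n - \<A>" using UB(1) by (simp add: \<A>_def)
  qed
qed

lemma continuum_X: "continuum X"
  unfolding continuum_def
  using compact_X nonempty_X connected_X
  by (simp add: metrizable_space_subtopology metrizable_space_euclidean)

text \<open>
  The traces on \<open>X\<close> of the members of a late stage form a fine cover. Two members may have the same
  trace and intersections may be lost, so the nerve of the traces is compared with that of the stage by
  choosing for each trace one member inducing it. The two points keep the members too small to
  contain all of \<open>X\<close>, since a one-point nerve is not a tree.
\<close>

lemma tree_like_X:
  assumes pq: "p \<in> X" "q \<in> X" "p \<noteq> q"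
  shows "tree_like X"
  unfolding tree_like_def
proof (intro allI impI, elim conjE)
  fix \<O> assume opn: "\<forall>G\<in>\<O>. openin (top_of_set X) G" and cov: "\<Union>\<O> = X"
  obtain \<epsilon> where e: "0 < \<epsilon>" "\<And>x. x \<in> X \<Longrightarrow> \<exists>G\<in>\<O>. X \<inter> ball x \<epsilon> \<subseteq> G"
    using Lebesgue_number_openin[OF compact_X, of \<O>] opn cov by (metis order_refl)
  have pos: "0 < min \<epsilon> (dist p q)" using e(1) pq(3) by simp
  obtain n where n: "n \<ge> 1"
      "\<And>U x y. U \<in> \<U> n \<Longrightarrow> x \<in> U \<Longrightarrow> y \<in> U \<Longrightarrow> dist x y < min \<epsilon> (dist p q)"
    using small_stage[OF pos] by metis
  define \<W> where "\<W> = (\<lambda>U. X \<inter> U) ` \<U> n - {{}}"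
  \<comment> \<open>Injective, since a trace is recovered from the chosen member.\<close>
  define h where "h W = (SOME U. U \<in> \<U> n \<and> X \<inter> U = W)" for W
  have h: "h W \<in> \<U> n" "X \<inter> h W = W" if "W \<in> \<W>" for W
  proof -
    have "\<exists>U. U \<in> \<U> n \<and> X \<inter> U = W" using that by (auto simp: \<W>_def)
    from someI_ex[OF this] show "h W \<in> \<U> n" "X \<inter> h W = W" by (simp_all add: h_def)
  qed
  have fin: "finite \<W>" unfolding \<W>_def using finite_chain[OF n(1)] by simp
  have XU: "X \<subseteq> \<Union>(\<U> n)" using n(1) by (auto simp: X_def)
  have WX: "\<Union>\<W> = X" using XU unfolding \<W>_def by blast
  have opW: "openin (top_of_set X) W" if "W \<in> \<W>" for W
    using that open_chain[OF n(1)] by (auto simp: \<W>_def)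
  obtain P Q where PQ: "P \<in> \<W>" "p \<in> P" "Q \<in> \<W>" "q \<in> Q" using WX pq by blast
  have "P \<noteq> Q"
  proof
    assume "P = Q"
    then have "p \<in> h P" "q \<in> h P" "h P \<in> \<U> n" using h[of P] PQ by auto
    then show False using n(2)[of "h P" p q] by simp
  qed
  have "is_tree (geometric_realization (nerve \<W>))"
  proof (rule is_tree_nerve_of_connected_cover[OF tree_nerve[OF n(1)], of h])
    show "h \<in> \<W> \<rightarrow> \<U> n" using h by blast
    show "inj_on h \<W>" using h(2) by (metis inj_onI)
    show "h A \<inter> h B \<noteq> {}" if "A \<in> \<W>" "B \<in> \<W>" "A \<inter> B \<noteq> {}" for A B
      using h(2)[OF that(1)] h(2)[OF that(2)] that(3) by blast
    show "connected X" by (rule connected_X)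
    show "X \<subseteq> \<Union>\<W>" using WX by simp
    show "openin (top_of_set X) (X \<inter> W)" "X \<inter> W \<noteq> {}" if "W \<in> \<W>" for W
    proof -
      have "X \<inter> W = W" using WX that by blast
      moreover have "W \<noteq> {}" using that by (simp add: \<W>_def)
      ultimately show "openin (top_of_set X) (X \<inter> W)" "X \<inter> W \<noteq> {}"
        using opW[OF that] by simp_all
    qed
  qed (use fin PQ \<open>P \<noteq> Q\<close> in auto)
  moreover have "\<exists>G\<in>\<O>. W \<subseteq> G" if W: "W \<in> \<W>" for W
  proof -
    obtain x where x: "x \<in> W" using W by (auto simp: \<W>_def)
    then have "x \<in> X" using WX W by blast
    then obtain G where G: "G \<in> \<O>" "X \<inter> ball x \<epsilon> \<subseteq> G" using e(2) by blast
    have "W \<subseteq> ball x \<epsilon>"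
    proof
      fix y assume "y \<in> W"
      then show "y \<in> ball x \<epsilon>" using n(2)[OF h(1)[OF W], of x y] h(2)[OF W] x by auto
    qed
    then have "W \<subseteq> G" using G(2) WX W by blast
    then show ?thesis using G(1) by blast
  qed
  ultimately show "\<exists>\<V>. finite \<V> \<and> (\<forall>V\<in>\<V>. openin (top_of_set X) V) \<and> \<Union>\<V> = X \<and>
      (\<forall>V\<in>\<V>. \<exists>U\<in>\<O>. V \<subseteq> U) \<and> is_tree (geometric_realization (nerve \<V>))"
    using fin opW WX by blast
qed

text \<open>
  The pattern prescribes \<open>f\<close> approximately: a point of \<open>V \<in> \<U> (Suc n)\<close> should go near \<open>\<phi> n V\<close>. Let
  \<open>S n x\<close> be the union of the sets \<open>\<phi> n V\<close> over all \<open>V\<close> in \<open>\<U> (Suc n)\<close> containing \<open>x\<close>. The third condition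
  makes any two of them meet, so \<open>S n x\<close> has diameter at most twice the mesh of \<open>\<U> n\<close>; the second makes
  \<open>S n x\<close> decrease with \<open>n\<close>. So the closures shrink to one point, the value at \<open>x\<close>. Two points in a common \<open>V\<close>
  have the points of \<open>\<phi> n V\<close> in common in their approximations, which gives continuity. The first condition
  keeps \<open>S 1 x\<close> away from every member of \<open>\<U> 1\<close> that contains \<open>x\<close>, so \<open>x\<close> is not in its closure.
\<close>

lemma fixed_point_free_map:
  assumes "follows_D2'_pattern \<U>"
  obtains f where "continuous_on X f" "f \<in> X \<rightarrow> X" "\<And>x. x \<in> X \<Longrightarrow> f x \<noteq> x"
proof -
  obtain \<phi> where \<phi>: "\<forall>n\<ge>1. \<phi> n \<in> \<U> (n + 1) \<rightarrow> \<U> n"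
    "\<forall>U\<in>\<U> 1. \<forall>V\<in>\<U> 2. U \<inter> V \<noteq> {} \<longrightarrow> \<phi> 1 V \<inter> U = {}"
    "\<forall>n\<ge>1. \<forall>U\<in>\<U> (n + 2). \<forall>V\<in>\<U> (n + 1). closure U \<subseteq> V \<longrightarrow> \<phi> (n + 1) U \<subseteq> \<phi> n V"
    "\<forall>n\<ge>1. \<forall>U\<in>\<U> (n + 1). \<forall>V\<in>\<U> (n + 1). U \<inter> V \<noteq> {} \<longrightarrow> \<phi> n U \<inter> \<phi> n V \<noteq> {}"
    using assms unfolding follows_D2'_pattern_def by (elim exE conjE) (rule that)
  have maps: "\<phi> n V \<in> \<U> n" if "n \<ge> 1" "V \<in> \<U> (Suc n)" for n V
    using \<phi>(1) that by (simp add: Pi_iff)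
  have D1: "\<phi> 1 V \<inter> U = {}" if "U \<in> \<U> 1" "V \<in> \<U> 2" "U \<inter> V \<noteq> {}" for U V
    using \<phi>(2) that by blast
  have D2: "\<phi> (Suc n) U \<subseteq> \<phi> n V"
    if "n \<ge> 1" "U \<in> \<U> (Suc (Suc n))" "V \<in> \<U> (Suc n)" "closure U \<subseteq> V" for n U V
    using \<phi>(3)[rule_format, of n U V] that by simp
  have D3: "\<phi> n U \<inter> \<phi> n V \<noteq> {}"
    if "n \<ge> 1" "U \<in> \<U> (Suc n)" "V \<in> \<U> (Suc n)" "U \<inter> V \<noteq> {}" for n U V
    using \<phi>(4)[rule_format, of n U V] that by simp
  define S where "S n x = (\<Union>V\<in>{V \<in> \<U> (Suc n). x \<in> V}. \<phi> n V)" for n x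
  have member: "\<exists>V\<in>\<U> n. x \<in> V" if "x \<in> X" "n \<ge> 1" for x n
    using that by (auto simp: X_def)
  have ne: "\<phi> n V \<noteq> {}" if "n \<ge> 1" "V \<in> \<U> (Suc n)" "x \<in> V" for n V x
    using D3[of n V V] that by auto
  have S_ne: "S n x \<noteq> {}" if "x \<in> X" "n \<ge> 1" for n x
    using member[of x "Suc n"] ne[OF that(2)] that by (fastforce simp: S_def)
  have S_Suc: "S (Suc n) x \<subseteq> S n x" if n: "n \<ge> 1" for n x
  proof
    fix y assume "y \<in> S (Suc n) x"
    then obtain U where U: "U \<in> \<U> (Suc (Suc n))" "x \<in> U" "y \<in> \<phi> (Suc n) U"
      by (auto simp: S_def)
    obtain V where V: "V \<in> \<U> (Suc n)" "closure U \<subseteq> V"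
      using refine[of "Suc n"] U(1) by (auto simp: strongly_refines_def)
    then have "x \<in> V" using U(2) closure_subset by blast
    then show "y \<in> S n x" using D2[OF n U(1) V] V(1) U(3) by (auto simp: S_def)
  qed
  have S_anti: "S n x \<subseteq> S m x" if "1 \<le> m" "m \<le> n" for m n x
    using that(2)
  proof (induction n rule: dec_induct)
    case (step n)
    have "S (Suc n) x \<subseteq> S n x" using S_Suc step(1) \<open>1 \<le> m\<close> by simp
    then show ?case using step by blast
  qed simp
  have S_small: "dist y z \<le> 2 * e"
    if n: "n \<ge> 1" and small: "\<And>U x y. U \<in> \<U> n \<Longrightarrow> x \<in> U \<Longrightarrow> y \<in> U \<Longrightarrow> dist x y < e"
      and yz: "y \<in> closure (S n x)" "z \<in> closure (S n x)" for n e x y z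
  proof -
    have *: "dist y z \<le> 2 * e" if yz: "y \<in> S n x" "z \<in> S n x" for y z
    proof -
      obtain V where V: "V \<in> \<U> (Suc n)" "x \<in> V" "y \<in> \<phi> n V" using yz by (auto simp: S_def)
      obtain W where W: "W \<in> \<U> (Suc n)" "x \<in> W" "z \<in> \<phi> n W" using yz by (auto simp: S_def)
      obtain u where "u \<in> \<phi> n V" "u \<in> \<phi> n W" using D3[OF n V(1) W(1)] V(2) W(2) by blast
      then have "dist y u < e" "dist u z < e"
        using small maps[OF n V(1)] maps[OF n W(1)] V(3) W(3) by blast+
      then show ?thesis using dist_triangle[of y z u] by linarith
    qed
    have "closure (S n x) \<subseteq> cball y (2 * e)" if "y \<in> S n x" for y
      using * that by (intro closure_minimal) auto
    then have "S n x \<subseteq> cball z (2 * e)" using yz(2) by (fastforce simp: dist_commute)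
    then have "closure (S n x) \<subseteq> cball z (2 * e)" by (intro closure_minimal) auto
    then show ?thesis using yz(1) by (auto simp: dist_commute)
  qed
  \<comment> \<open>Approximations begin at stage 1, the nested sequence of closed sets at 0: hence \<open>Suc n\<close>.\<close>
  have "\<exists>y. \<forall>n\<ge>1. y \<in> closure (S n x)" if x: "x \<in> X" for x
  proof -
    have "\<exists>a. \<Inter>(range (\<lambda>n. closure (S (Suc n) x))) = {a}"
    proof (rule decreasing_closed_nest_sing)
      show "closure (S (Suc n) x) \<noteq> {}" for n using S_ne[OF x, of "Suc n"] by simp
      show "closure (S (Suc n) x) \<subseteq> closure (S (Suc m) x)" if "m \<le> n" for m n
        using S_anti[of "Suc m" "Suc n" x] that by (intro closure_mono) simp
      fix e :: real assume "0 < e"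
      then obtain N where N: "N \<ge> 1"
          "\<And>n U x y. n \<ge> N \<Longrightarrow> U \<in> \<U> n \<Longrightarrow> x \<in> U \<Longrightarrow> y \<in> U \<Longrightarrow> dist x y < e/3"
        using eventually_small[of "e/3"] by auto
      have "dist y z < e" if "y \<in> closure (S (Suc N) x)" "z \<in> closure (S (Suc N) x)" for y z
        using S_small[of "Suc N" "e/3" y x z] N(2)[of "Suc N"] that \<open>0 < e\<close> by fastforce
      then show "\<exists>n. \<forall>y\<in>closure (S (Suc n) x). \<forall>z\<in>closure (S (Suc n) x). dist y z < e" by blast
    qed simp
    then obtain a where "\<And>n. a \<in> closure (S (Suc n) x)" by blast
    then have "\<forall>n\<ge>1. a \<in> closure (S n x)" by (metis Suc_le_D One_nat_def)
    then show ?thesis by blast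
  qed
  then obtain f where f: "\<And>x n. x \<in> X \<Longrightarrow> n \<ge> 1 \<Longrightarrow> f x \<in> closure (S n x)" by metis
  show thesis
  proof (rule that)
    show "f \<in> X \<rightarrow> X"
    proof
      fix x assume x: "x \<in> X"
      have "f x \<in> \<Union>(\<U> n)" if n: "n \<ge> 1" for n
      proof -
        have "S (Suc n) x \<subseteq> \<Union>(\<U> (Suc n))" using maps[of "Suc n"] by (auto simp: S_def)
        then have "closure (S (Suc n) x) \<subseteq> \<Union>(\<U> n)"
          using closure_Union_Suc[OF n] closure_mono by blast
        then show ?thesis using f[OF x, of "Suc n"] by auto
      qed
      then show "f x \<in> X" by (simp add: X_def)
    qed
  next
    show "continuous_on X f"
      unfolding continuous_on_iff
    proof (intro ballI allI impI)
      fix x e assume x: "x \<in> X" and e: "(0::real) < e"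
      have pos: "0 < e/5" using e by simp
      obtain n where n: "n \<ge> 1" "\<And>U x y. U \<in> \<U> n \<Longrightarrow> x \<in> U \<Longrightarrow> y \<in> U \<Longrightarrow> dist x y < e/5"
        using small_stage[OF pos] by metis
      obtain V where V: "V \<in> \<U> (Suc n)" "x \<in> V" using member[OF x, of "Suc n"] by auto
      \<comment> \<open>A point \<open>w\<close> shared by the approximations at \<open>x\<close> and \<open>y\<close>: each value is within \<open>2e/5\<close> of it.\<close>
      obtain w where w: "w \<in> \<phi> n V" using ne[OF n(1) V] by blast
      obtain d where d: "0 < d" "ball x d \<subseteq> V"
        using open_chain[of "Suc n" V] V by (auto simp: open_contains_ball)
      have "dist (f y) (f x) < e" if y: "y \<in> X" "dist y x < d" for y
      proof -
        have "y \<in> V" using d y by (auto simp: dist_commute)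
        then have "w \<in> S n x" "w \<in> S n y" using V w by (auto simp: S_def)
        then have w: "w \<in> closure (S n x)" "w \<in> closure (S n y)" using closure_subset by blast+
        have "dist (f x) w \<le> 2 * (e/5)" by (rule S_small[OF n f[OF x n(1)] w(1)])
        moreover have "dist (f y) w \<le> 2 * (e/5)" by (rule S_small[OF n f[OF y(1) n(1)] w(2)])
        ultimately show ?thesis using dist_triangle2[of "f y" "f x" w] e by linarith
      qed
      then show "\<exists>d>0. \<forall>y\<in>X. dist y x < d \<longrightarrow> dist (f y) (f x) < e" using d(1) by blast
    qed
  next
    fix x assume x: "x \<in> X"
    show "f x \<noteq> x"
    proof
      assume fx: "f x = x"
      obtain U where U: "U \<in> \<U> 1" "x \<in> U" using member[OF x, of 1] by auto
      have "\<phi> 1 V \<inter> U = {}" if "V \<in> \<U> 2" "x \<in> V" for V using D1 U that by blast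
      then have "S 1 x \<inter> U = {}" by (auto simp: S_def numeral_2_eq_2)
      then have "closure (S 1 x) \<inter> U = {}"
        using open_chain[of 1 U] U(1) by (simp add: open_Int_closure_eq_empty Int_commute)
      then show False using f[OF x, of 1] fx U(2) by auto
    qed
  qed
qed

end

lemma fpf_tree_chain_sequence_limit:
  fixes \<U> :: "nat \<Rightarrow> 'a::heine_borel set set"
  assumes "fpf_tree_chain_sequence \<U>"
  defines "X \<equiv> \<Inter>n\<in>{1..}. \<Union>(\<U> n)"
  shows "continuum X \<and> tree_like X \<and> \<not> fixed_point_property X"
proof -
  interpret L: shrinking_tree_chains \<U>
    by unfold_locales (use assms(1) in \<open>auto simp: fpf_tree_chain_sequence_def\<close>)
  have X: "L.X = X" by (simp add: L.X_def X_def)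
  have "follows_D2'_pattern \<U>" using assms(1) by (simp add: fpf_tree_chain_sequence_def)
  then obtain f where f: "continuous_on X f" "f \<in> X \<rightarrow> X" "\<And>x. x \<in> X \<Longrightarrow> f x \<noteq> x"
    using L.fixed_point_free_map unfolding X by metis
  obtain p where p: "p \<in> X" using L.nonempty_X unfolding X by blast
  have "tree_like X"
    using L.tree_like_X[of p "f p"] p f unfolding X by (metis PiE)
  moreover have "\<not> fixed_point_property X"
    using f unfolding fixed_point_property_def by blast
  ultimately show ?thesis using L.continuum_X unfolding X by blast
qed

section \<open>Tree-chains around a tree-like continuum\<close>

text \<open>
  The part of \<open>V\<close> that stays at distance at least \<open>r\<close> from \<open>X - V\<close>.
\<close>

definition core :: "'a::metric_space set \<Rightarrow> real \<Rightarrow> 'a set \<Rightarrow> 'a set" where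
  "core X r V = {x \<in> X. X \<inter> ball x r \<subseteq> V}"

text \<open>
  Enlarging all of \<open>V\<close>, however little, could make disjoint members with touching closures meet.
  Enlarging only the core leaves room: the radius \<open>r/4\<close> is small enough that even closures of
  two enlargements meet only if their cores come closer than \<open>r\<close>.
\<close>

definition thicken :: "'a::metric_space set \<Rightarrow> real \<Rightarrow> 'a set \<Rightarrow> 'a set" where
  "thicken X r V = (\<Union>x\<in>core X r V. ball x (r/4))"

lemma open_thicken: "open (thicken X r V)"
  by (auto simp: thicken_def)

lemma core_subset: "0 < r \<Longrightarrow> core X r V \<subseteq> V"
  by (auto simp: core_def)

lemma core_subset_thicken: "0 < r \<Longrightarrow> core X r V \<subseteq> thicken X r V"
  by (force simp: thicken_def)

lemma mem_coreD: "x \<in> core X r V \<Longrightarrow> y \<in> X \<Longrightarrow> dist x y < r \<Longrightarrow> y \<in> V"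
  by (auto simp: core_def)

lemma thicken_near_core:
  assumes "z \<in> closure (thicken X r V)" "0 < r"
  obtains x where "x \<in> core X r V" "dist x z < r/2"
proof -
  obtain w where w: "w \<in> thicken X r V" "dist w z < r/4"
    using assms unfolding closure_approachable by (metis zero_less_divide_iff zero_less_numeral)
  then obtain x where "x \<in> core X r V" "dist x w < r/4" by (auto simp: thicken_def)
  moreover have "dist x z \<le> dist x w + dist w z" by metric
  ultimately show thesis using w that by auto
qed

text \<open>
  Excludes at once new intersections between thickened sets and touching closures of disjoint ones.
\<close>

lemma closures_thicken_meet:
  assumes "0 < r" "closure (thicken X r V) \<inter> closure (thicken X r W) \<noteq> {}"
  shows "X \<inter> V \<inter> W \<noteq> {}"
proof -
  obtain z where z: "z \<in> closure (thicken X r V)" "z \<in> closure (thicken X r W)" using assms by blast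
  obtain x where x: "x \<in> core X r V" "dist x z < r/2" using thicken_near_core[OF z(1) assms(1)] .
  obtain y where y: "y \<in> core X r W" "dist y z < r/2" using thicken_near_core[OF z(2) assms(1)] .
  have "dist x y \<le> dist x z + dist y z" by metric
  then have "dist x y < r" using x y by linarith
  moreover have "y \<in> X" using y by (simp add: core_def)
  ultimately have "y \<in> V" using mem_coreD[OF x(1)] by blast
  moreover have "y \<in> W" using core_subset[OF assms(1)] y(1) by blast
  ultimately show ?thesis using \<open>y \<in> X\<close> by blast
qed

lemma finite_uniform_positive:
  assumes "finite A" "\<And>a. a \<in> A \<Longrightarrow> \<exists>r>0. Q a r"
    and anti: "\<And>a r s. Q a r \<Longrightarrow> 0 < s \<Longrightarrow> s \<le> r \<Longrightarrow> Q a s"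
  shows "\<exists>r>0::real. \<forall>a\<in>A. Q a r"
  using assms(1,2)
proof (induction A rule: finite_induct)
  case empty
  then show ?case by (auto intro: exI[of _ 1])
next
  case (insert a A)
  obtain r where r: "r > 0" "\<forall>b\<in>A. Q b r" using insert by blast
  obtain s where s: "s > 0" "Q a s" using insert.prems by blast
  have "\<forall>b\<in>insert a A. Q b (min r s)"
    using r s anti[of _ _ "min r s"] by (metis insertE min.cobounded1 min.cobounded2 min_less_iff_conj)
  then show ?case using r(1) s(1) by (metis min_less_iff_conj)
qed

text \<open>
  The tree-chains from which the sequence is built. The Lebesgue number \<open>\<mu>\<close> refers to full balls of the
  ambient space; every intersection between members is witnessed inside \<open>X\<close>, where the map is defined.
\<close>

definition taut_tree_cover :: "'a::metric_space set \<Rightarrow> 'a set set \<Rightarrow> real \<Rightarrow> bool" where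
  "taut_tree_cover X \<U> \<mu> \<longleftrightarrow> 0 < \<mu> \<and> tree_chain \<U> \<and> taut \<U> \<and>
     (\<forall>x\<in>X. \<exists>U\<in>\<U>. ball x \<mu> \<subseteq> U) \<and>
     (\<forall>U\<in>\<U>. \<forall>V\<in>\<U>. U \<inter> V \<noteq> {} \<longrightarrow> X \<inter> U \<inter> V \<noteq> {}) \<and> {} \<notin> \<U>"

text \<open>
  Tree-likeness gives a fine cover \<open>\<V>\<close> of \<open>X\<close> by relatively open sets with a tree as nerve. For small \<open>r\<close>
  the sets \<open>thicken X r V\<close> are a fine taut family of open sets of the ambient space. Their intersection
  pattern is that of \<open>\<V>\<close> once \<open>r\<close> is so small that every nonempty pairwise
  intersection of members has a point in both cores, and distinct members stay distinct once each
  nonempty difference of two members has a point in the core of the first.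
\<close>

lemma taut_tree_cover_exists:
  assumes X: "continuum X" and tl: "tree_like X" and e: "0 < e"
  shows "\<exists>\<U> \<mu>. taut_tree_cover X \<U> \<mu> \<and> (\<forall>U\<in>\<U>. \<forall>x\<in>U. \<forall>y\<in>U. dist x y < e)"
proof -
  have cpt: "compact X" and con: "connected X" using X by (auto simp: continuum_def)
  have "\<exists>\<V>. finite \<V> \<and> (\<forall>V\<in>\<V>. openin (top_of_set X) V) \<and> \<Union>\<V> = X \<and>
      (\<forall>V\<in>\<V>. \<exists>U\<in>(\<lambda>x. X \<inter> ball x (e/4)) ` X. V \<subseteq> U) \<and>
      is_tree (geometric_realization (nerve \<V>))"
    using e by (intro tl[unfolded tree_like_def, rule_format] conjI) auto
  then obtain \<V>0 where V0: "finite \<V>0" "\<And>V. V \<in> \<V>0 \<Longrightarrow> openin (top_of_set X) V" "\<Union>\<V>0 = X"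
      "\<And>V. V \<in> \<V>0 \<Longrightarrow> \<exists>x. V \<subseteq> ball x (e/4)" and tree: "is_tree (geometric_realization (nerve \<V>0))"
    by fastforce
  \<comment> \<open>The empty set is not a vertex of the nerve and would have no point to map.\<close>
  define \<V> where "\<V> = \<V>0 - {{}}"
  have V: "finite \<V>" "\<And>V. V \<in> \<V> \<Longrightarrow> V \<in> \<V>0" "\<And>V. V \<in> \<V> \<Longrightarrow> V \<noteq> {}" "\<Union>\<V> = X"
    using V0(1,3) by (auto simp: \<V>_def)
  have inner: "\<exists>r>0. X \<inter> ball p r \<subseteq> V" if V': "V \<in> \<V>" and p: "p \<in> V" for V p
  proof -
    obtain T where T: "open T" "V = X \<inter> T" using V0(2)[OF V(2)[OF V']] by (meson openin_open)
    then obtain r where "r > 0" "ball p r \<subseteq> T" using p by (meson IntD2 open_contains_ball)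
    then show ?thesis using T(2) by blast
  qed
  \<comment> \<open>Finitely many witnesses have to lie in cores: one per intersecting pair and one per noninclusion.\<close>
  have "\<exists>r>0. \<forall>a\<in>\<V> \<times> \<V>. (fst a \<inter> snd a \<noteq> {} \<longrightarrow> core X r (fst a) \<inter> core X r (snd a) \<noteq> {}) \<and>
      (\<not> fst a \<subseteq> snd a \<longrightarrow> (\<exists>p\<in>core X r (fst a). p \<notin> snd a))" (is "\<exists>r>0. \<forall>a\<in>_. ?Q a r")
  proof (rule finite_uniform_positive)
    show "finite (\<V> \<times> \<V>)" using V(1) by simp
    have core_anti: "core X r W \<subseteq> core X s W" if "s \<le> r" for r s W
      using that by (force simp: core_def)
    show "?Q a s" if "?Q a r" "0 < s" "s \<le> r" for a r s
      using that(1) core_anti[OF that(3), of "fst a"] core_anti[OF that(3), of "snd a"] by blast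
    fix a assume "a \<in> \<V> \<times> \<V>"
    then have a: "fst a \<in> \<V>" "snd a \<in> \<V>" by auto
    have 1: "\<exists>r>0. fst a \<inter> snd a \<noteq> {} \<longrightarrow> core X r (fst a) \<inter> core X r (snd a) \<noteq> {}"
    proof (cases "fst a \<inter> snd a = {}")
      case True
      then show ?thesis by (auto intro: exI[of _ 1])
    next
      case False
      then obtain p where p: "p \<in> fst a" "p \<in> snd a" by blast
      obtain r s where "r > 0" "X \<inter> ball p r \<subseteq> fst a" "s > 0" "X \<inter> ball p s \<subseteq> snd a"
        using inner a p by metis
      moreover have "p \<in> X" using a p V(4) by blast
      ultimately have "p \<in> core X (min r s) (fst a) \<inter> core X (min r s) (snd a)"
        by (force simp: core_def)
      then show ?thesis using \<open>r > 0\<close> \<open>s > 0\<close> by (intro exI[of _ "min r s"]) auto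
    qed
    have 2: "\<exists>r>0. \<not> fst a \<subseteq> snd a \<longrightarrow> (\<exists>p\<in>core X r (fst a). p \<notin> snd a)"
    proof (cases "fst a \<subseteq> snd a")
      case True
      then show ?thesis by (auto intro: exI[of _ 1])
    next
      case False
      then obtain p where p: "p \<in> fst a" "p \<notin> snd a" by blast
      obtain r where "r > 0" "X \<inter> ball p r \<subseteq> fst a" using inner a p by metis
      moreover have "p \<in> X" using a p V(4) by blast
      ultimately show ?thesis using p(2) by (intro exI[of _ r]) (auto simp: core_def)
    qed
    obtain r where r: "r > 0" "fst a \<inter> snd a \<noteq> {} \<longrightarrow> core X r (fst a) \<inter> core X r (snd a) \<noteq> {}"
      using 1 by blast
    obtain s where s: "s > 0" "\<not> fst a \<subseteq> snd a \<longrightarrow> (\<exists>p\<in>core X s (fst a). p \<notin> snd a)"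
      using 2 by blast
    have mono: "core X r W \<subseteq> core X (min r s) W" "core X s W \<subseteq> core X (min r s) W" for W
      by (simp_all add: core_anti)
    have "?Q a (min r s)"
    proof (intro conjI impI)
      assume "fst a \<inter> snd a \<noteq> {}"
      then have "core X r (fst a) \<inter> core X r (snd a) \<noteq> {}" using r(2) by simp
      then show "core X (min r s) (fst a) \<inter> core X (min r s) (snd a) \<noteq> {}"
        using mono(1)[of "fst a"] mono(1)[of "snd a"] by blast
    next
      assume "\<not> fst a \<subseteq> snd a"
      then show "\<exists>p\<in>core X (min r s) (fst a). p \<notin> snd a" using s(2) mono(2)[of "fst a"] by blast
    qed
    then show "\<exists>r>0. ?Q a r" using r(1) s(1) by (intro exI[of _ "min r s"] conjI) simp_all
  qed
  then obtain r0 where r0: "r0 > 0"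
    "\<And>A B. A \<in> \<V> \<Longrightarrow> B \<in> \<V> \<Longrightarrow> A \<inter> B \<noteq> {} \<Longrightarrow> core X r0 A \<inter> core X r0 B \<noteq> {}"
    "\<And>A B. A \<in> \<V> \<Longrightarrow> B \<in> \<V> \<Longrightarrow> \<not> A \<subseteq> B \<Longrightarrow> \<exists>p\<in>core X r0 A. p \<notin> B"
    by (metis SigmaI fst_conv snd_conv)
  obtain r1 where r1: "0 < r1" "\<And>x. x \<in> X \<Longrightarrow> \<exists>A\<in>\<V>. X \<inter> ball x r1 \<subseteq> A"
    using Lebesgue_number_openin[OF cpt, of \<V>] V0(2) V(2,4) by (metis order_refl)
  define r where "r = min (min r0 r1) e"
  have r: "0 < r" "r \<le> r0" "r \<le> r1" "r \<le> e" using r0(1) r1(1) e by (auto simp: r_def)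
  have core_r: "core X r0 A \<subseteq> core X r A" for A using r(2) by (force simp: core_def)
  have meet: "core X r A \<inter> core X r B \<noteq> {}" if "A \<in> \<V>" "B \<in> \<V>" "A \<inter> B \<noteq> {}" for A B
    using r0(2)[OF that] core_r by blast
  have leb: "\<exists>A\<in>\<V>. x \<in> core X r A" if "x \<in> X" for x
  proof -
    obtain A where A: "A \<in> \<V>" "X \<inter> ball x r1 \<subseteq> A" using r1(2) \<open>x \<in> X\<close> by blast
    have "x \<in> core X r A" using \<open>x \<in> X\<close> A(2) r(3) by (force simp: core_def)
    then show ?thesis using A(1) by blast
  qed
  define T where "T = thicken X r"
  have meetT: "X \<inter> A \<inter> B \<noteq> {}" if "closure (T A) \<inter> closure (T B) \<noteq> {}" for A B
    using closures_thicken_meet[OF r(1)] that by (simp add: T_def)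
  have meetT': "A \<inter> B \<noteq> {}" if "T A \<inter> T B \<noteq> {}" for A B
    using meetT[of A B] that closure_subset[of "T A"] closure_subset[of "T B"] by blast
  have sub: "X \<inter> T A \<subseteq> A" for A
  proof
    fix y assume "y \<in> X \<inter> T A"
    then obtain x where "x \<in> core X r A" "dist x y < r/4" "y \<in> X" by (auto simp: T_def thicken_def)
    then show "y \<in> A" using mem_coreD[of x X r A y] r(1) by simp
  qed
  have coreT: "core X r A \<subseteq> X \<inter> T A" for A
    using core_subset_thicken[OF r(1)] by (auto simp: T_def core_def)
  have meetX: "X \<inter> T A \<inter> T B \<noteq> {}" if "A \<in> \<V>" "B \<in> \<V>" "A \<inter> B \<noteq> {}" for A B
    using meet[OF that] coreT by blast
  have injT: "inj_on T \<V>"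
  proof (rule inj_onI, rule ccontr)
    have *: "T A \<noteq> T B" if AB: "A \<in> \<V>" "B \<in> \<V>" "\<not> A \<subseteq> B" for A B
    proof -
      obtain p where "p \<in> core X r0 A" "p \<notin> B" using r0(3)[OF AB] by blast
      then have "p \<in> X \<inter> T A" "p \<notin> B" using core_r coreT by blast+
      then show ?thesis using sub by blast
    qed
    fix A B assume "A \<in> \<V>" "B \<in> \<V>" "T A = T B" "A \<noteq> B"
    then show False using *[of A B] *[of B A] by blast
  qed
  define \<U> where "\<U> = T ` \<V>"
  \<comment> \<open>The way back from thickened sets to the original cover, for comparing the nerves.\<close>
  define h where "h = inv_into \<V> T"
  have hT: "h (T A) = A" if "A \<in> \<V>" for A using that injT by (simp add: h_def)
  have intU: "X \<inter> U \<inter> V \<noteq> {}" if UV: "U \<in> \<U>" "V \<in> \<U>" "U \<inter> V \<noteq> {}" for U V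
  proof -
    obtain A B where AB: "A \<in> \<V>" "B \<in> \<V>" "U = T A" "V = T B" using UV by (auto simp: \<U>_def)
    then have "A \<inter> B \<noteq> {}" using meetT' UV(3) by blast
    then show ?thesis using meetX AB by blast
  qed
  have meetsX: "X \<inter> U \<noteq> {}" if U: "U \<in> \<U>" for U
  proof -
    obtain A where A: "A \<in> \<V>" "U = T A" using U by (auto simp: \<U>_def)
    then show ?thesis using meetX[of A A] V(3)[of A] by auto
  qed
  have leb': "\<exists>U\<in>\<U>. ball x (r/4) \<subseteq> U" if "x \<in> X" for x
    using leb[OF that] unfolding \<U>_def T_def thicken_def by blast
  obtain A0 B0 where "A0 \<in> \<V>0" "B0 \<in> \<V>0" "A0 \<noteq> {}" "B0 \<noteq> {}" "A0 \<noteq> B0"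
    using tree_realization_two_vertices[OF tree] by metis
  then have AB0: "A0 \<in> \<V>" "B0 \<in> \<V>" "A0 \<noteq> B0" by (simp_all add: \<V>_def)
  have "is_tree (geometric_realization (nerve \<U>))"
  proof (rule is_tree_nerve_of_connected_cover[OF tree, of h])
    show "h \<in> \<U> \<rightarrow> \<V>0" using hT V(2) by (auto simp: \<U>_def)
    show "inj_on h \<U>" using hT by (auto simp: \<U>_def inj_on_def)
    show "h U \<inter> h V \<noteq> {}" if UV: "U \<in> \<U>" "V \<in> \<U>" "U \<inter> V \<noteq> {}" for U V
    proof -
      obtain A B where AB: "A \<in> \<V>" "B \<in> \<V>" "U = T A" "V = T B" using UV by (auto simp: \<U>_def)
      then show ?thesis using meetT'[of A B] UV(3) hT by simp
    qed
    show "finite \<U>" using V(1) by (simp add: \<U>_def)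
    show "T A0 \<in> \<U>" "T B0 \<in> \<U>" using AB0 by (auto simp: \<U>_def)
    show "T A0 \<noteq> T B0" using AB0 injT by (auto simp: inj_on_eq_iff)
    show "X \<subseteq> \<Union>\<U>"
    proof
      fix x assume "x \<in> X"
      then obtain U where "U \<in> \<U>" "ball x (r/4) \<subseteq> U" using leb' by blast
      moreover have "x \<in> ball x (r/4)" using r(1) by simp
      ultimately show "x \<in> \<Union>\<U>" by blast
    qed
    show "openin (top_of_set X) (X \<inter> W)" if "W \<in> \<U>" for W
      using that open_thicken[of X r] by (auto simp: \<U>_def T_def)
    show "X \<inter> W \<noteq> {}" if "W \<in> \<U>" for W using meetsX that .
  qed (rule con)
  then have "tree_chain \<U>"
    using V(1) open_thicken[of X r] by (auto simp: tree_chain_def \<U>_def T_def)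
  moreover have "taut \<U>"
    unfolding taut_def
  proof (intro ballI impI, rule ccontr)
    fix U V assume UV: "U \<in> \<U>" "V \<in> \<U>" "U \<inter> V = {}" "closure U \<inter> closure V \<noteq> {}"
    obtain A B where AB: "A \<in> \<V>" "B \<in> \<V>" "U = T A" "V = T B" using UV by (auto simp: \<U>_def)
    then have "A \<inter> B \<noteq> {}" using meetT[of A B] UV(4) by blast
    then show False using meetX[OF AB(1,2)] UV(3) AB by blast
  qed
  moreover have "{} \<notin> \<U>" using meetsX by blast
  ultimately have "taut_tree_cover X \<U> (r/4)"
    unfolding taut_tree_cover_def using r(1) leb' intU by auto
  moreover have "dist x y < e" if U: "U \<in> \<U>" and x: "x \<in> U" and y: "y \<in> U" for U x y
  proof -
    obtain A where A: "A \<in> \<V>" "U = T A" using U by (auto simp: \<U>_def)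
    obtain a where a: "A \<subseteq> ball a (e/4)" using V0(4) V(2) A by blast
    have *: "dist a z < e/2" if "z \<in> U" for z
    proof -
      obtain c where c: "c \<in> core X r A" "dist c z < r/4"
        using \<open>z \<in> U\<close> A by (auto simp: T_def thicken_def)
      have "dist a c < e/4" using c(1) a core_subset[OF r(1)] by fastforce
      then show ?thesis using c(2) r(4) dist_triangle[of a z c] by linarith
    qed
    show ?thesis using *[OF x] *[OF y] dist_triangle3[of x y a] by linarith
  qed
  ultimately show ?thesis by blast
qed

section \<open>From a map without fixed points to a pattern\<close>

text \<open>
  Let \<open>\<eta>\<close> be the least displacement of a map \<open>f\<close> without fixed points. The tree-chains are chosen successively,
  with mesh below \<open>\<eta>/3\<close> and so fine in terms of the Lebesgue number \<open>\<mu>\<close> of the previous one that members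
  have diameter at most \<open>\<mu>/2\<close> and so do the images under \<open>f\<close> of their traces. Then \<open>\<phi> n V\<close> is any
  member of \<open>\<U> n\<close> that contains the ball of radius \<open>\<mu> n\<close> about some \<open>f x\<close> with \<open>x\<close> in \<open>X \<inter> V\<close>.
  Such a member contains all of \<open>f (X \<inter> V)\<close> with room to spare, and this room accommodates every set
  \<open>\<phi> (Suc n) U\<close> with \<open>U\<close> inside \<open>V\<close>, as that set is small and meets \<open>f (X \<inter> V)\<close>.
\<close>

lemma fpf_tree_chain_sequence_exists:
  fixes X :: "'a::metric_space set"
  assumes X: "continuum X" and tl: "tree_like X" and nofp: "\<not> fixed_point_property X"
  shows "\<exists>\<U> :: nat \<Rightarrow> 'a set set. fpf_tree_chain_sequence \<U>"
proof -
  obtain f where f: "continuous_on X f" "\<And>x. x \<in> X \<Longrightarrow> f x \<in> X" "\<And>x. x \<in> X \<Longrightarrow> f x \<noteq> x"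
    using nofp unfolding fixed_point_property_def by blast
  have cpt: "compact X" and X0: "X \<noteq> {}" using X by (auto simp: continuum_def)
  have "continuous_on X (\<lambda>x. dist x (f x))" by (intro continuous_intros f(1))
  then obtain x0 where x0: "x0 \<in> X" "\<And>x. x \<in> X \<Longrightarrow> dist x0 (f x0) \<le> dist x (f x)"
    using continuous_attains_inf[OF cpt X0] by blast
  define \<eta> where "\<eta> = dist x0 (f x0)"
  have eta: "0 < \<eta>" "\<And>x. x \<in> X \<Longrightarrow> \<eta> \<le> dist x (f x)"
    using x0 f(3)[of x0] by (simp_all add: \<eta>_def)
  define P where "P n s \<longleftrightarrow> taut_tree_cover X (fst s) (snd s) \<and>
      (\<forall>U\<in>fst s. \<forall>x\<in>U. \<forall>y\<in>U. dist x y < min (\<eta>/3) (1 / real (Suc n)))" for n :: nat and s :: "'a set set \<times> real"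
  define R where "R s t \<longleftrightarrow> (\<forall>V\<in>fst t. \<forall>x\<in>V. \<forall>y\<in>V. dist x y < snd s / 2 \<and>
      (x \<in> X \<longrightarrow> y \<in> X \<longrightarrow> dist (f x) (f y) < snd s / 2))" for s t :: "'a set set \<times> real"
  have "\<exists>s. \<forall>n. P n (s n) \<and> R (s n) (s (Suc n))"
  proof (rule dependent_nat_choice)
    show "\<exists>s. P 0 s"
      using taut_tree_cover_exists[OF X tl, of "min (\<eta>/3) (1 / real (Suc 0))"] eta(1)
      by (auto simp: P_def)
    fix s n assume "P n s"
    then have mu: "snd s / 2 > 0" by (simp add: P_def taut_tree_cover_def)
    then obtain d where d: "d > 0" "\<And>x y. x \<in> X \<Longrightarrow> y \<in> X \<Longrightarrow> dist x y < d \<Longrightarrow> dist (f x) (f y) < snd s / 2"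
      using compact_uniformly_continuous[OF f(1) cpt] unfolding uniformly_continuous_on_def by metis
    obtain \<U> \<mu> where U: "taut_tree_cover X \<U> \<mu>"
        "\<forall>U\<in>\<U>. \<forall>x\<in>U. \<forall>y\<in>U. dist x y < min (min (\<eta>/3) (1 / real (Suc (Suc n)))) (min (snd s / 2) d)"
      using taut_tree_cover_exists[OF X tl, of "min (min (\<eta>/3) (1 / real (Suc (Suc n)))) (min (snd s / 2) d)"]
        eta(1) mu d(1) by auto
    have "P (Suc n) (\<U>, \<mu>)" using U by (simp add: P_def)
    moreover have "R s (\<U>, \<mu>)" using U(2) d(2) by (simp add: R_def)
    ultimately show "\<exists>t. P (Suc n) t \<and> R s t" by blast
  qed
  then obtain s where s: "\<And>n. P n (s n)" "\<And>n. R (s n) (s (Suc n))" by blast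
  define \<U> where "\<U> n = fst (s n)" for n
  define \<mu> where "\<mu> n = snd (s n)" for n
  have cover: "\<mu> n > 0" "tree_chain (\<U> n)" "taut (\<U> n)" "{} \<notin> \<U> n"
    "\<And>x. x \<in> X \<Longrightarrow> \<exists>U\<in>\<U> n. ball x (\<mu> n) \<subseteq> U"
    "\<And>U V. U \<in> \<U> n \<Longrightarrow> V \<in> \<U> n \<Longrightarrow> U \<inter> V \<noteq> {} \<Longrightarrow> X \<inter> U \<inter> V \<noteq> {}" for n
    using s(1)[of n] by (auto simp: P_def taut_tree_cover_def \<U>_def \<mu>_def)
  have small: "dist x y < \<eta>/3" "dist x y < 1 / real (Suc n)"
    if "U \<in> \<U> n" "x \<in> U" "y \<in> U" for U x y n
    using s(1)[of n] that by (auto simp: P_def \<U>_def)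
  have next_small: "dist x y < \<mu> n / 2" "x \<in> X \<Longrightarrow> y \<in> X \<Longrightarrow> dist (f x) (f y) < \<mu> n / 2"
    if "V \<in> \<U> (Suc n)" "x \<in> V" "y \<in> V" for V x y n
    using s(2)[of n] that by (auto simp: R_def \<U>_def \<mu>_def)
  have meetsX: "\<exists>x. x \<in> X \<and> x \<in> V" if "V \<in> \<U> n" for V n
    using cover(6)[OF that that] cover(4)[of n] that by auto
  define \<phi> where "\<phi> n V = (SOME U. U \<in> \<U> n \<and> (\<exists>x\<in>X \<inter> V. ball (f x) (\<mu> n) \<subseteq> U))" for n V
  have phi: "\<phi> n V \<in> \<U> n \<and> (\<exists>x\<in>X \<inter> V. ball (f x) (\<mu> n) \<subseteq> \<phi> n V)" if V: "V \<in> \<U> (Suc n)" for n V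
  proof -
    obtain x where x: "x \<in> X" "x \<in> V" using meetsX[OF V] by blast
    obtain U where "U \<in> \<U> n" "ball (f x) (\<mu> n) \<subseteq> U" using cover(5)[OF f(2)[OF x(1)]] by blast
    then have "\<exists>U. U \<in> \<U> n \<and> (\<exists>x\<in>X \<inter> V. ball (f x) (\<mu> n) \<subseteq> U)" using x by blast
    from someI_ex[OF this] show ?thesis by (simp add: \<phi>_def)
  qed
  have f_phi: "f y \<in> \<phi> n V" if V: "V \<in> \<U> (Suc n)" and y: "y \<in> X" "y \<in> V" for n V y
  proof -
    obtain x where x: "x \<in> X" "x \<in> V" "ball (f x) (\<mu> n) \<subseteq> \<phi> n V" using phi[OF V] by blast
    have "dist (f x) (f y) < \<mu> n" using next_small(2)[OF V x(2) y(2) x(1) y(1)] cover(1)[of n] by linarith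
    then show ?thesis using x(3) by auto
  qed
  have "follows_D2'_pattern \<U>"
    unfolding follows_D2'_pattern_def
  proof (intro exI[of _ \<phi>] conjI allI ballI impI)
    show "\<phi> n \<in> \<U> (n + 1) \<rightarrow> \<U> n" for n using phi by auto
  next
    fix U V assume U: "U \<in> \<U> 1" and V: "V \<in> \<U> 2" and UV: "U \<inter> V \<noteq> {}"
    have V': "V \<in> \<U> (Suc 1)" using V by (simp add: numeral_2_eq_2)
    show "\<phi> 1 V \<inter> U = {}"
    proof (rule ccontr)
      assume "\<phi> 1 V \<inter> U \<noteq> {}"
      then obtain w where w: "w \<in> \<phi> 1 V" "w \<in> U" by blast
      obtain z where z: "z \<in> U" "z \<in> V" using UV by blast
      obtain x where x: "x \<in> X" "x \<in> V" using meetsX[OF V] by blast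
      have "dist x z < \<eta>/3" using small(1)[OF V x(2) z(2)] .
      moreover have "dist z w < \<eta>/3" using small(1)[OF U z(1) w(2)] .
      \<comment> \<open>Three sets of diameter below \<open>\<eta>/3\<close> chain \<open>x\<close> to its image: \<open>V\<close>, \<open>U\<close> and \<open>\<phi> 1 V\<close>.\<close>
      moreover have "dist w (f x) < \<eta>/3"
        using small(1)[of "\<phi> 1 V" 1 w "f x"] phi[OF V'] w(1) f_phi[OF V' x] by blast
      moreover have "dist x (f x) \<le> dist x z + dist z w + dist w (f x)" by metric
      ultimately show False using eta(2)[OF x(1)] by linarith
    qed
  next
    fix n U V assume "U \<in> \<U> (n + 2)" "V \<in> \<U> (n + 1)" and UV: "closure U \<subseteq> V"
    then have U: "U \<in> \<U> (Suc (Suc n))" and V: "V \<in> \<U> (Suc n)" by simp_all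
    obtain x where x: "x \<in> X" "x \<in> U" using meetsX[OF U] by blast
    have "x \<in> V" using x(2) UV closure_subset by blast
    obtain y where y: "y \<in> X" "y \<in> V" "ball (f y) (\<mu> n) \<subseteq> \<phi> n V" using phi[OF V] by blast
    have "\<phi> (Suc n) U \<subseteq> ball (f y) (\<mu> n)"
    proof
      fix z assume z: "z \<in> \<phi> (Suc n) U"
      have "dist (f x) z < \<mu> n / 2"
        using next_small(1)[of "\<phi> (Suc n) U" n "f x" z] phi[OF U] f_phi[OF U x] z by blast
      moreover have "dist (f y) (f x) < \<mu> n / 2"
        using next_small(2)[OF V y(2) \<open>x \<in> V\<close> y(1) x(1)] .
      ultimately show "z \<in> ball (f y) (\<mu> n)" using dist_triangle[of "f y" z "f x"] by simp
    qed
    then show "\<phi> (n + 1) U \<subseteq> \<phi> n V" using y(3) by simp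
  next
    fix n U V assume "U \<in> \<U> (n + 1)" "V \<in> \<U> (n + 1)" and UV: "U \<inter> V \<noteq> {}"
    then have U: "U \<in> \<U> (Suc n)" and V: "V \<in> \<U> (Suc n)" by simp_all
    obtain p where "p \<in> X" "p \<in> U" "p \<in> V" using cover(6)[OF U V UV] by blast
    then have "f p \<in> \<phi> n U" "f p \<in> \<phi> n V" using f_phi U V by blast+
    then show "\<phi> n U \<inter> \<phi> n V \<noteq> {}" by blast
  qed
  moreover have "strongly_refines (\<U> (n + 1)) (\<U> n)" for n
    unfolding strongly_refines_def
  proof
    fix V assume "V \<in> \<U> (n + 1)"
    then have V: "V \<in> \<U> (Suc n)" by simp
    obtain x where x: "x \<in> X" "x \<in> V" using meetsX[OF V] by blast
    obtain U where U: "U \<in> \<U> n" "ball x (\<mu> n) \<subseteq> U" using cover(5)[OF x(1)] by blast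
    have "V \<subseteq> cball x (\<mu> n / 2)" using next_small(1)[OF V x(2)] by (fastforce intro: less_imp_le simp: mem_cball)
    then have "closure V \<subseteq> cball x (\<mu> n / 2)" by (intro closure_minimal) auto
    also have "\<dots> \<subseteq> ball x (\<mu> n)" using cover(1)[of n] by auto
    finally show "\<exists>U\<in>\<U> n. closure V \<subseteq> U" using U by blast
  qed
  moreover have "(\<lambda>n. mesh (\<U> n)) \<longlonglongrightarrow> 0"
  proof (rule tendsto_sandwich[OF _ _ tendsto_const])
    show "\<forall>\<^sub>F n in sequentially. mesh (\<U> n) \<le> ennreal (1 / real (Suc n))"
      using small(2) by (intro always_eventually allI mesh_leI) (blast intro: less_imp_le)
    have "(\<lambda>n. ennreal (1 / real (Suc n))) \<longlonglongrightarrow> ennreal 0"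
      using LIMSEQ_inverse_real_of_nat by (intro tendsto_ennrealI) (simp add: inverse_eq_divide)
    then show "(\<lambda>n. ennreal (1 / real (Suc n))) \<longlonglongrightarrow> 0" by simp
  qed simp
  ultimately have "fpf_tree_chain_sequence \<U>"
    using cover(2,3) by (simp add: fpf_tree_chain_sequence_def)
  then show ?thesis by blast
qed

section \<open>Planar continua\<close>

theorem corollary3p4:
  shows "(\<forall>\<U> :: nat \<Rightarrow> (real^2) set set. fpf_tree_chain_sequence \<U> \<longrightarrow>
            (let X = (\<Inter>n\<in>{1..}. \<Union>(\<U> n)) in
               continuum X \<and> tree_like X \<and> \<not> fixed_point_property X)) \<and>
         ((\<nexists>\<U> :: nat \<Rightarrow> (real^2) set set. fpf_tree_chain_sequence \<U>) \<longrightarrow>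
            (\<forall>X :: (real^2) set. continuum X \<and> tree_like X \<longrightarrow> fixed_point_property X))"
proof (intro conjI impI allI)
  fix \<U> :: "nat \<Rightarrow> (real^2) set set" assume "fpf_tree_chain_sequence \<U>"
  then show "let X = (\<Inter>n\<in>{1..}. \<Union>(\<U> n)) in continuum X \<and> tree_like X \<and> \<not> fixed_point_property X"
    unfolding Let_def by (rule fpf_tree_chain_sequence_limit)
next
  fix X :: "(real^2) set"
  assume none: "\<nexists>\<U> :: nat \<Rightarrow> (real^2) set set. fpf_tree_chain_sequence \<U>" and X: "continuum X \<and> tree_like X"
  show "fixed_point_property X"
  proof (rule ccontr)
    assume "\<not> fixed_point_property X"
    then have "\<exists>\<U> :: nat \<Rightarrow> (real^2) set set. fpf_tree_chain_sequence \<U>"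
      using X by (intro fpf_tree_chain_sequence_exists) simp_all
    with none show False by (rule notE)
  qed
qed

end
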